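(* Let the vector of random moments $\mathbf{m}_{2n-1}\in\mathcal{M}_{2n-1}(\mathbb{R})$ be governed by a law with density $$h_{2n-1}^{(\gamma,\delta)}(\mathbf{m}_{2n-1})=\prod_{k=1}^n\sqrt{\frac{\delta_{2k-1}}{\pi}}\exp\big(-\delta_{2k-1}b_k^2(\mathbf{m}_{2n-1})\big)\times\prod_{k=1}^{n-1}\frac{\delta_{2k}^{\gamma_k+2n-2k}}{\Gamma(\gamma_k+2n-2k)}a_k^{\gamma_k}(\mathbf{m}_{2n-1})\exp\big(-\delta_{2k}a_k(\mathbf{m}_{2n-1})\big)\mathbf{1}_{\{a_k(\mathbf{m}_{2n-1})>0\}},$$ where the parameters $\gamma_k>-1$ are fixed and $\delta_k=n$ $(k=1,\dots,n)$. For $k\in\mathbb{N}$ denote by $\mathbf{m}_k^{(n)}$ the projection of $\mathbf{m}_{2n-1}$ onto its first $k$ coordinates and by $\mathbf{m}_k(\rho)$ the vector of the first $k$ moments of the semicircle law $\rho$, i.e. the first $k$ entries of $(0,c_1,0,c_2,\dots)$ with $c_j=\frac1{j+1}\binom{2j}{j}$. Then $$\sqrt{2n}\,D^{-1}\big(\mathbf{m}_k^{(n)}-\mathbf{m}_k(\rho)\big)\longrightarrow\mathcal{N}_k(0,I_k)$$ in distribution as $n\to\infty$, where $D=(d_{i,j})$ is a $k\times k$ lower triangular matrix with $d_{i,j}=0$ if $i+j$ is odd, and the remaining entries (for $j\le i$, $i+j$ even) are given by $$d_{i,j}=\binom{i}{\frac{i-j}{2}}-\binom{i}{\frac{i-j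}{2}-1}.$$
   Context: $\mathcal{P}(\mathbb{R})$ is the set of Borel probability measures on $\mathbb{R}$ with all moments existing, $m_k(\mu)=\int x^k\,\mu(dx)$, and $\mathcal{M}_{2n-1}(\mathbb{R})=\{(m_1(\mu),\dots,m_{2n-1}(\mu))^T:\mu\in\mathcal{P}(\mathbb{R})\}\subset\mathbb{R}^{2n-1}$. Densities are with respect to Lebesgue measure and vanish outside the interior of the moment space. The parameters of the density $h_{2n-1}^{(\gamma,\delta)}$ are real numbers $\gamma_k>-1$ and $\delta_k>0$. For $\mathbf{m}_{2n-1}=(m_1,\dots,m_{2n-1})^T$ in the interior of $\mathcal{M}_{2n-1}(\mathbb{R})$, let $P_0=1,P_1,\dots,P_n$ be the monic orthogonal polynomials associated with $\mathbf{m}_{2n-1}$ (orthogonal with respect to every probability measure with first moments $m_1,\dots,m_{2n-1}$). They satisfy $P_1(x)=x-b_1$ and $$xP_k(x)=P_{k+1}(x)+b_{k+1}P_k(x)+a_kP_{k-1}(x),\qquad k=1,\dots,n-1,$$ with $b_k=b_k(\mathbf{m}_{2n-1})\in\mathbb{R}$ and $a_k=a_k(\mathbf{m}_{2n-1})>0$. The map $\mathbf{m}_{2n-1}\mapsto(b_1,a_1,\dots,a_{n-1},b_n)^T$ is a bijection from the interior of $\mathcal{M}_{2n-1}(\mathbb{R})$ onto $(\mathbb{R}\times\mathbb{R}^+)^{n-1}\times\mathbb{R}$. Wigner's semicircle law is $d\rho(x)=\frac1{2\pi}\sqrt{4-x^2}\,\mathbf{1}_{\{-2<x<2\}}\,dx$,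 with moments $m_{2j}(\rho)=c_j=\frac1{j+1}\binom{2j}{j}$ and $m_{2j-1}(\rho)=0$. Binomial coefficients with negative lower entry are $0$. $\mathcal{N}_k(0,I_k)$ is the standard normal distribution on $\mathbb{R}^k$.
   Formalization: The formal theorem takes δ_j = n for odd j and δ_j = 2n for even j (j ≤ n) instead of δ_j = n for all j: with δ_2 = n, a_1 has mean tending to 2, so m_2 tends to 2 rather than c_1 = 1 and the claim fails for every k ≥ 2. *)

theory Defs
  imports
    "HOL-Probability.Probability"
    "HOL-Computational_Algebra.Polynomial"
    "Jordan_Normal_Form.Gauss_Jordan_Elimination"
begin

text \<open>
  Throughout, a point of \<open>\<real>\<^sup>I\<close> (\<open>I\<close> a finite set of indices) is an extensional function in
  \<open>I \<rightarrow>\<^sub>E UNIV\<close>, with the product topology, the product \<open>\<sigma>\<close>-algebra and the product Lebesgue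
  measure.  Vectors of moments are indexed by \<open>{1..N}\<close>, so that \<open>m i\<close> is the \<open>i\<close>-th moment.
\<close>

section \<open>Moment spaces\<close>

definition prob_all_moments :: "real measure set" where
  "prob_all_moments =
     {\<mu>. prob_space \<mu> \<and> sets \<mu> = sets borel \<and> (\<forall>k::nat. integrable \<mu> (\<lambda>x. x ^ k))}"

definition moment :: "real measure \<Rightarrow> nat \<Rightarrow> real" where
  "moment \<mu> k = (LINT x|\<mu>. x ^ k)"

definition moment_space :: "nat \<Rightarrow> (nat \<Rightarrow> real) set" where
  "moment_space N = (\<lambda>\<mu>. \<lambda>i\<in>{1..N}. moment \<mu> i) ` prob_all_moments"

definition interior_moment_space :: "nat \<Rightarrow> (nat \<Rightarrow> real) set" where
  "interior_moment_space N =
     (product_topology (\<lambda>_. euclideanreal) {1..N}) interior_of (moment_space N)"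

section \<open>Orthogonal polynomials and recursion coefficients\<close>

text \<open>The family \<open>P 0, \<dots>, P n\<close> (values beyond \<open>n\<close> are irrelevant) for
  \<open>m = (m\<^sub>1, \<dots>, m\<^bsub>2n-1\<^esub>)\<close>.\<close>

definition monic_orthogonal_polys :: "nat \<Rightarrow> (nat \<Rightarrow> real) \<Rightarrow> (nat \<Rightarrow> real poly) \<Rightarrow> bool" where
  "monic_orthogonal_polys n m P \<longleftrightarrow>
     (\<forall>k\<le>n. degree (P k) = k \<and> lead_coeff (P k) = 1) \<and>
     (\<forall>\<mu>\<in>prob_all_moments. (\<forall>i\<in>{1..2*n-1}. moment \<mu> i = m i) \<longrightarrow>
        (\<forall>j\<le>n. \<forall>k\<le>n. j \<noteq> k \<longrightarrow> (LINT x|\<mu>. poly (P j) x * poly (P k) x) = 0))"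

definition recursion_coeffs ::
    "nat \<Rightarrow> (nat \<Rightarrow> real) \<Rightarrow> (nat \<Rightarrow> real) \<Rightarrow> (nat \<Rightarrow> real) \<Rightarrow> bool" where
  "recursion_coeffs n m b a \<longleftrightarrow>
     (\<exists>P. monic_orthogonal_polys n m P \<and>
          P 1 = [:- b 1, 1:] \<and>
          (\<forall>k\<in>{1..n-1}. [:0, 1:] * P k =
              P (k + 1) + Polynomial.smult (b (k + 1)) (P k) + Polynomial.smult (a k) (P (k - 1))))"

text \<open>For \<open>m\<close> in the interior of the moment space of order \<open>2n - 1\<close> the values \<open>b 1, \<dots>, b n\<close> and
  \<open>a 1, \<dots>, a (n - 1)\<close> are uniquely determined; the functions below are only used there.\<close>

definition rec_b :: "nat \<Rightarrow> (nat \<Rightarrow> real) \<Rightarrow> nat \<Rightarrow> real" where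
  "rec_b n m k = (THE \<beta>. \<exists>b a. recursion_coeffs n m b a \<and> b k = \<beta>)"

definition rec_a :: "nat \<Rightarrow> (nat \<Rightarrow> real) \<Rightarrow> nat \<Rightarrow> real" where
  "rec_a n m k = (THE \<alpha>. \<exists>b a. recursion_coeffs n m b a \<and> a k = \<alpha>)"

section \<open>The density on the moment space\<close>

text \<open>The Jacobian of \<open>(b\<^sub>1, a\<^sub>1, \<dots>, a\<^bsub>n-1\<^esub>, b\<^sub>n) \<mapsto> m\<close> is \<open>\<Prod>k<n. a\<^sub>k ^ (2n - 2k - 1)\<close>.  Hence under
  this density the recursion coefficients are independent, \<open>b\<^sub>k\<close> is centred normal with variance
  \<open>1 / (2 \<delta>\<^bsub>2k-1\<^esub>)\<close>, and \<open>a\<^sub>k\<close> is gamma distributed with shape \<open>\<gamma>\<^sub>k + 2n - 2k\<close> and rate \<open>\<delta>\<^bsub>2k\<^esub>\<close>.\<close>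

definition moment_density ::
    "nat \<Rightarrow> (nat \<Rightarrow> real) \<Rightarrow> (nat \<Rightarrow> real) \<Rightarrow> (nat \<Rightarrow> real) \<Rightarrow> real" where
  "moment_density n \<gamma> \<delta> m =
     (if m \<in> interior_moment_space (2*n-1) then
        (\<Prod>k=1..n. sqrt (\<delta> (2*k-1) / pi) * exp (- \<delta> (2*k-1) * (rec_b n m k)\<^sup>2)) *
        (\<Prod>k=1..n-1.
            \<delta> (2*k) powr (\<gamma> k + 2 * real n - 2 * real k) / Gamma (\<gamma> k + 2 * real n - 2 * real k)
            * rec_a n m k powr \<gamma> k * exp (- \<delta> (2*k) * rec_a n m k)
            * (if rec_a n m k > 0 then 1 else 0))
      else 0)"

section \<open>The semicircle law and the limit matrix\<close>

definition semicircle :: "real measure" where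
  "semicircle =
     density lborel (\<lambda>x. ennreal (1 / (2 * pi) * sqrt (4 - x\<^sup>2) * indicator {-2<..<2} x))"

definition D_entry :: "nat \<Rightarrow> nat \<Rightarrow> real" where
  "D_entry i j =
     (if j \<le> i \<and> even (i + j)
      then real (i choose ((i - j) div 2)) -
           (if i = j then 0 else real (i choose ((i - j) div 2 - 1)))
      else 0)"

text \<open>Matrices and vectors of \<^theory>\<open>Jordan_Normal_Form.Matrix\<close> are indexed from \<open>0\<close>.\<close>

definition D_mat :: "nat \<Rightarrow> real mat" where
  "D_mat k = Matrix.mat k k (\<lambda>(i, j). D_entry (i + 1) (j + 1))"

text \<open>\<open>sqrt (2n) D\<^sup>-\<^sup>1 (m\<^sub>k - m\<^sub>k(\<rho>))\<close> as a point of \<open>\<real>\<^sup>k\<close>, with coordinates \<open>{..<k}\<close>.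
  Only \<open>m 1, \<dots>, m k\<close> enter, so \<open>m\<close> may be a longer vector of moments.  As \<open>D\<close> is lower
  unitriangular, \<^const>\<open>mat_inverse\<close> does not return \<^const>\<open>None\<close>.\<close>

definition normalized_moments :: "nat \<Rightarrow> nat \<Rightarrow> (nat \<Rightarrow> real) \<Rightarrow> nat \<Rightarrow> real" where
  "normalized_moments n k m =
     (\<lambda>i\<in>{..<k}. vec_index
        (sqrt (2 * real n) \<cdot>\<^sub>v
          (the (mat_inverse (D_mat k)) *\<^sub>v
             Matrix.vec k (\<lambda>i. m (i + 1) - moment semicircle (i + 1)))) i)"

section \<open>Convergence in distribution\<close>

text \<open>The library's \<^const>\<open>weak_conv_m\<close> is restricted to measures on the real line.\<close>

definition weak_conv_on :: "'a topology \<Rightarrow> (nat \<Rightarrow> 'a measure) \<Rightarrow> 'a measure \<Rightarrow> bool" where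
  "weak_conv_on T M N \<longleftrightarrow>
     (\<forall>f::'a \<Rightarrow> real. continuous_map T euclideanreal f \<and> bounded (f ` topspace T) \<longrightarrow>
        (\<lambda>n. LINT x|M n. f x) \<longlonglongrightarrow> (LINT x|N. f x))"

definition std_normal_vector :: "nat \<Rightarrow> (nat \<Rightarrow> real) measure" where
  "std_normal_vector k = (\<Pi>\<^sub>M i\<in>{..<k}. std_normal_distribution)"

end

theory Submission
  imports Defs "HOL-Real_Asymp.Real_Asymp" "Jordan_Normal_Form.Determinant"
begin

text \<open>
  A moment vector in the interior of the moment space is a polynomial function, the moment map, of its
  recursion coefficients \<open>b\<^sub>1, a\<^sub>1, b\<^sub>2, \<dots>\<close>, and in these coordinates the random vector becomes simple.
  The moment map is triangular, its Jacobian is a product of powers of the \<open>a\<^sub>k\<close>, and the density is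
  made so that the coefficients are independent: \<open>b\<^sub>k\<close> is normal with variance \<open>1 / (2n)\<close>, and \<open>a\<^sub>k\<close> is
  gamma distributed with shape \<open>2n + O(1)\<close> and rate \<open>2n\<close>, as long as \<open>k\<close> stays bounded
  (\<open>interior_moment_space_recursion\<close>, \<open>change_of_variables_moment_map\<close>, \<open>distr_moments_eq\<close>).  So \<open>b\<^sub>k\<close>
  concentrates at \<open>0\<close> and \<open>a\<^sub>k\<close> at \<open>1\<close>, which are the recursion coefficients of the semicircle law, and
  \<open>sqrt (2n) b\<^sub>k\<close> and \<open>sqrt (2n) (a\<^sub>k - 1)\<close> are independent and asymptotically standard normal.

  It remains to see that \<open>D\<close> is the derivative of the moment map at the semicircle coefficients.  The
  \<open>j\<close>-th moment is a weighted sum over Motzkin paths, \<open>path_sum u j 0\<close>, that is, the entry \<open>(0, 0)\<close> of the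
  \<open>j\<close>-th power of a Jacobi matrix.  Its deviation from the semicircle moment is expanded exactly by
  Duhamel's formula, and in first order the two factors around the perturbation count nonnegative
  paths.  Their numbers are the entries of \<open>D\<close>, and a convolution identity for them identifies the
  derivative (\<open>D_entry_convolution\<close>, \<open>moments_linearize\<close>).

  For the passage to the limit each coefficient is standardized by an affine map, the expectation of a
  bounded continuous function becomes an integral over \<open>\<real>\<^sup>k\<close>, and dominated convergence applies: the
  densities converge to the standard normal density and the integrand converges because \<open>D\<^sup>-\<^sup>1\<close> inverts the
  linearization.  The domination of the standardized gamma densities also yields the limit of their
  normalizing constants, so that Stirling's formula is a by-product
  (\<open>gamma_profile_le\<close>, \<open>gamma_const_tendsto\<close>, \<open>normalized_moments_tendsto\<close>).
\<close>

section \<open>Ballot numbers\<close>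

lemma D_entry_diagonal_offset:
  "D_entry (i + 2 * r) i =
     real ((i + 2 * r) choose r) - (if r = 0 then 0 else real ((i + 2 * r) choose (r - 1)))"
  by (auto simp: D_entry_def)

lemma D_entry_eq_0: "j < i \<Longrightarrow> D_entry j i = 0"
  by (simp add: D_entry_def)

lemma D_entry_odd: "odd (i + j) \<Longrightarrow> D_entry i j = 0"
  by (simp add: D_entry_def)

lemma D_entry_0: "D_entry 0 i = (if i = 0 then 1 else 0)"
  by (simp add: D_entry_def)

lemma D_entry_refl: "D_entry i i = 1"
  by (simp add: D_entry_def)

text \<open>The entry \<open>D_entry j i\<close> is a ballot number: by the reflection principle it counts the paths of
  \<open>j\<close> steps \<open>\<plusminus>1\<close> from height \<open>i\<close> to height \<open>0\<close> that never go below \<open>0\<close>.  The recurrence looks at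
  the first step; here it follows from Pascal's rule.\<close>

lemma D_entry_Suc:
  "D_entry (Suc j) i = D_entry j (Suc i) + (if i = 0 then 0 else D_entry j (i - 1))"
proof (cases "odd (Suc j + i)")
  case True
  then have "odd (j + Suc i)" "i \<noteq> 0 \<Longrightarrow> odd (j + (i - 1))" by auto
  with True show ?thesis using D_entry_odd by auto
next
  case even: False
  consider "i > Suc j" | "i = Suc j" | "i \<le> j" by linarith
  then show ?thesis
  proof cases
    case 1
    then show ?thesis by (simp add: D_entry_eq_0)
  next
    case 2
    then show ?thesis by (simp add: D_entry_eq_0 D_entry_refl)
  next
    case 3
    with even have "even (Suc j - i)" "Suc j - i > 0" by auto
    then obtain q where q: "Suc j - i = 2 * q" "q > 0"
      by (metis dvdE nat_0_less_mult_iff)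
    define r where "r = q - 1"
    have j: "j = Suc i + 2 * r" using 3 q by (simp add: r_def)
    have up: "D_entry (Suc j) i = real (Suc j choose (r + 1)) - real (Suc j choose r)"
      using D_entry_diagonal_offset[of i "r + 1"] j by simp
    have dn: "D_entry j (Suc i) = real (j choose r) - (if r = 0 then 0 else real (j choose (r - 1)))"
      using D_entry_diagonal_offset[of "Suc i" r] j by simp
    have pascal: "real (Suc j choose r) =
        real (j choose r) + (if r = 0 then 0 else real (j choose (r - 1)))"
      by (cases r) auto
    show ?thesis
    proof (cases "i = 0")
      case True
      have "j choose (r + 1) = j choose r"
        using binomial_symmetric[of r j] j True by (simp add: ac_simps)
      then show ?thesis using True up dn pascal by simp
    next
      case False
      then have "D_entry j (i - 1) = real (j choose (r + 1)) - real (j choose r)"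
        using D_entry_diagonal_offset[of "i - 1" "r + 1"] j by simp
      then show ?thesis using False up dn pascal by simp
    qed
  qed
qed

text \<open>A path from height \<open>p + q + 1\<close> to \<open>0\<close> is cut at its first arrival at height \<open>q\<close>, whose last step
  leads from \<open>q + 1\<close> to \<open>q\<close>: before that step it is a path from \<open>p\<close> to \<open>0\<close> lifted by \<open>q + 1\<close>, after
  it a path from \<open>q\<close> to \<open>0\<close>.\<close>

lemma D_entry_convolution:
  "(\<Sum>t<j. D_entry t p * D_entry (j - 1 - t) q) = D_entry j (p + q + 1)"
proof (induction j arbitrary: q)
  case 0
  then show ?case by (simp add: D_entry_0)
next
  case (Suc j)
  have "(\<Sum>t<j. D_entry t p * D_entry (j - t) q) =
        (\<Sum>t<j. D_entry t p * D_entry (j - 1 - t) (Suc q)) +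
        (if q = 0 then 0 else (\<Sum>t<j. D_entry t p * D_entry (j - 1 - t) (q - 1)))"
  proof -
    have "D_entry t p * D_entry (j - t) q = D_entry t p * D_entry (j - 1 - t) (Suc q) +
        (if q = 0 then 0 else D_entry t p * D_entry (j - 1 - t) (q - 1))" if "t < j" for t
    proof -
      have "j - t = Suc (j - 1 - t)" using that by simp
      then show ?thesis using D_entry_Suc[of "j - 1 - t" q] by (simp add: algebra_simps)
    qed
    then have "(\<Sum>t<j. D_entry t p * D_entry (j - t) q) =
       (\<Sum>t<j. D_entry t p * D_entry (j - 1 - t) (Suc q) +
        (if q = 0 then 0 else D_entry t p * D_entry (j - 1 - t) (q - 1)))" by simp
    then show ?thesis by (cases "q = 0") (simp_all add: sum.distrib)
  qed
  also have "\<dots> = D_entry j (p + Suc q + 1) + (if q = 0 then 0 else D_entry j (p + (q - 1) + 1))"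
    by (simp only: Suc.IH)
  finally show ?case
    using D_entry_Suc[of j "p + q + 1"] by (auto simp: D_entry_0)
qed

lemma D_entry_even_0: "(real r + 1) * D_entry (2 * r) 0 = real ((2 * r) choose r)"
proof (cases r)
  case 0
  then show ?thesis by (simp add: D_entry_0)
next
  case (Suc q)
  have "Suc q * ((2 * r) choose Suc q) = (2 * r - q) * ((2 * r) choose q)"
    by (metis binomial_absorb_comp binomial_absorption)
  then have "real (Suc q * ((2 * r) choose Suc q)) = real ((2 * r - q) * ((2 * r) choose q))"
    by (rule arg_cong)
  moreover have "real (2 * r - q) = real r + 1" using Suc by simp
  ultimately have y: "(real r + 1) * real ((2 * r) choose (r - 1)) = real r * real ((2 * r) choose r)"
    unfolding of_nat_mult Suc by (simp only: diff_Suc_1)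
  have "D_entry (2 * r) 0 = real ((2 * r) choose r) - real ((2 * r) choose (r - 1))"
    using D_entry_diagonal_offset[of 0 r] Suc by (simp del: binomial_Suc_Suc)
  then have "(real r + 1) * D_entry (2 * r) 0 =
      (real r + 1) * real ((2 * r) choose r) - (real r + 1) * real ((2 * r) choose (r - 1))"
    by (simp only: right_diff_distrib)
  then show ?thesis unfolding y by (simp add: distrib_right del: binomial_Suc_Suc)
qed

text \<open>The column \<open>0\<close> contains the Catalan numbers, interspersed with zeros.  This two-step recurrence is
  the one that integration by parts gives for the moments of the semicircle law.\<close>

lemma D_entry_column_0_recurrence:
  "(real i + 3) * D_entry (i + 1) 0 = 4 * real i * D_entry (i - 1) 0"
proof (cases "even i")
  case True
  then have "i = 0 \<or> odd (i - 1)" by auto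
  then show ?thesis using True D_entry_odd[of "i + 1" 0] D_entry_odd[of "i - 1" 0] by auto
next
  case False
  then obtain r where i: "i = 2 * r + 1" by (auto elim: oddE)
  have "Suc r * (Suc (2 * r + 1) choose Suc r) = Suc r * (2 * ((2 * r + 1) choose r))"
    unfolding Suc_times_binomial by simp
  then have "Suc (2 * r + 1) choose Suc r = 2 * ((2 * r + 1) choose r)"
    by (subst (asm) mult_left_cancel) auto
  moreover have "(2 * r + 1) choose r = Suc (2 * r) choose Suc r"
    using binomial_symmetric[of r "2 * r + 1"] by simp
  ultimately have "Suc r * (2 * (r + 1) choose (r + 1)) = 2 * (Suc (2 * r) * ((2 * r) choose r))"
    unfolding Suc_times_binomial[symmetric] by simp
  then have "real (Suc r * (2 * (r + 1) choose (r + 1))) =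
      real (2 * (Suc (2 * r) * ((2 * r) choose r)))"
    by (rule arg_cong)
  then have "(real r + 1) * real ((2 * (r + 1)) choose (r + 1)) =
      2 * (2 * real r + 1) * real ((2 * r) choose r)"
    unfolding of_nat_mult of_nat_Suc by (simp only: mult.assoc of_nat_numeral add.commute)
  then have "(real r + 1) * ((real (r + 1) + 1) * D_entry (2 * (r + 1)) 0) =
      2 * (2 * real r + 1) * ((real r + 1) * D_entry (2 * r) 0)"
    by (simp only: D_entry_even_0)
  then have "(real r + 1) * ((real r + 2) * D_entry (2 * (r + 1)) 0) =
      (real r + 1) * (2 * (2 * real r + 1) * D_entry (2 * r) 0)"
    by (simp add: algebra_simps)
  then have "(real r + 2) * D_entry (2 * (r + 1)) 0 = 2 * (2 * real r + 1) * D_entry (2 * r) 0"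
    by (subst (asm) mult_left_cancel) auto
  then show ?thesis using i by (simp add: algebra_simps)
qed

section \<open>Moments as path sums, and their linearization\<close>

text \<open>The moments as polynomials in the recursion coefficients, which are collected in one sequence:
  \<open>u (2k - 1) = b\<^sub>k\<close> and \<open>u (2k) = a\<^sub>k\<close>.  The value \<open>path_sum u j i\<close> is the sum, over the Motzkin paths
  of \<open>j\<close> steps from height \<open>i\<close> to \<open>0\<close>, of the product of the weights \<open>b\<^bsub>h+1\<^esub>\<close> of the level steps at
  height \<open>h\<close> and \<open>a\<^sub>h\<close> of the down steps from height \<open>h\<close>.  Equivalently it is the entry \<open>(i, 0)\<close> of the
  \<open>j\<close>-th power of the tridiagonal Jacobi matrix, and the integral of \<open>x\<^sup>j P\<^sub>i(x)\<close>; the \<open>j\<close>-th moment is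
  \<open>path_sum u j 0\<close>.\<close>

primrec path_sum :: "(nat \<Rightarrow> real) \<Rightarrow> nat \<Rightarrow> nat \<Rightarrow> real" where
  "path_sum u 0 i = (if i = 0 then 1 else 0)"
| "path_sum u (Suc j) i = path_sum u j (Suc i) + u (2 * i + 1) * path_sum u j i +
     (if i = 0 then 0 else u (2 * i) * path_sum u j (i - 1))"

text \<open>The recursion coefficients \<open>b\<^sub>k = 0\<close>, \<open>a\<^sub>k = 1\<close> of the semicircle law.\<close>

definition semicircle_coeffs :: "nat \<Rightarrow> real" where
  "semicircle_coeffs s = (if even s then 1 else 0)"

lemma path_sum_semicircle: "path_sum semicircle_coeffs j i = D_entry j i"
  by (induction j arbitrary: i) (auto simp: D_entry_0 D_entry_Suc semicircle_coeffs_def)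

text \<open>For the semicircle coefficients the Jacobi matrix is symmetric, so one step can be moved from one
  factor of the pairing to the other.\<close>

lemma D_entry_step_adjoint:
  "(\<Sum>i\<le>d. D_entry d i * (f (Suc i) + (if i = 0 then 0 else f (i - 1)))) =
   (\<Sum>i\<le>Suc d. D_entry (Suc d) i * f i)"
proof -
  have 1: "(\<Sum>i\<le>Suc d. (if i = 0 then 0 else D_entry d (i - 1)) * f i) =
      (\<Sum>i\<le>d. D_entry d i * f (Suc i))"
    by (subst sum.atMost_Suc_shift) simp
  have "(\<Sum>i\<le>Suc d. D_entry d i * (if i = 0 then 0 else f (i - 1))) =
      (\<Sum>i\<le>d. D_entry d (Suc i) * f i)"
    by (subst sum.atMost_Suc_shift) simp
  then have 2: "(\<Sum>i\<le>d. D_entry d i * (if i = 0 then 0 else f (i - 1))) =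
      (\<Sum>i\<le>Suc d. D_entry d (Suc i) * f i)"
    by (simp add: D_entry_eq_0)
  have "(\<Sum>i\<le>d. D_entry d i * (f (Suc i) + (if i = 0 then 0 else f (i - 1)))) =
    (\<Sum>i\<le>d. D_entry d i * f (Suc i)) + (\<Sum>i\<le>d. D_entry d i * (if i = 0 then 0 else f (i - 1)))"
    by (simp add: distrib_left sum.distrib)
  also have "\<dots> = (\<Sum>i\<le>Suc d. D_entry (Suc d) i * f i)"
    unfolding 2 1[symmetric] D_entry_Suc[of d] distrib_right sum.distrib by simp
  finally show ?thesis .
qed

definition coeff_perturbation :: "(nat \<Rightarrow> real) \<Rightarrow> nat \<Rightarrow> nat \<Rightarrow> real" where
  "coeff_perturbation u l i = u (2 * i + 1) * path_sum u l i +
     (if i = 0 then 0 else (u (2 * i) - 1) * path_sum u l (i - 1))"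

text \<open>The Duhamel formula for the powers of two matrices \<open>A\<close> and \<open>A\<^sub>0\<close>,
  \<open>A\<^sup>j = A\<^sub>0\<^sup>d A\<^bsup>j-d\<^esup> + (\<Sum>t<d. A\<^sub>0\<^sup>t (A - A\<^sub>0) A\<^bsup>j-1-t\<^esup>)\<close>, read off at the entry \<open>(0, 0)\<close>; \<open>A\<close> is the
  Jacobi matrix of \<open>u\<close> and \<open>A\<^sub>0\<close> that of the semicircle law.\<close>

lemma path_sum_telescope:
  assumes "d \<le> j"
  shows "path_sum u j 0 = (\<Sum>i\<le>d. D_entry d i * path_sum u (j - d) i) +
           (\<Sum>t<d. \<Sum>i\<le>t. D_entry t i * coeff_perturbation u (j - 1 - t) i)"
  using assms
proof (induction d)
  case 0
  then show ?case by (simp add: D_entry_0)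
next
  case (Suc d)
  define l where "l = j - Suc d"
  have l: "j - d = Suc l" "j - 1 - d = l" using Suc.prems by (auto simp: l_def)
  have "path_sum u (Suc l) i =
     (path_sum u l (Suc i) + (if i = 0 then 0 else path_sum u l (i - 1))) + coeff_perturbation u l i" for i
    by (simp add: coeff_perturbation_def algebra_simps)
  then have "(\<Sum>i\<le>d. D_entry d i * path_sum u (Suc l) i) =
     (\<Sum>i\<le>d. D_entry d i * (path_sum u l (Suc i) + (if i = 0 then 0 else path_sum u l (i - 1)))) +
     (\<Sum>i\<le>d. D_entry d i * coeff_perturbation u l i)"
    by (simp only: distrib_left[of "D_entry d _"] sum.distrib)
  also have "\<dots> = (\<Sum>i\<le>Suc d. D_entry (Suc d) i * path_sum u l i) +
     (\<Sum>i\<le>d. D_entry d i * coeff_perturbation u l i)"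
    by (simp only: D_entry_step_adjoint)
  finally show ?case
    using Suc.IH Suc.prems l by (simp add: l_def)
qed

text \<open>The deviation of a moment is an exact finite sum whose terms are linear in the deviation of the
  coefficients, up to a factor \<open>path_sum u\<close> that is continuous in \<open>u\<close>.  This makes the linearization
  below a passage to the limit in finitely many terms.\<close>

lemma path_sum_perturbation:
  "path_sum u j 0 - D_entry j 0 =
     (\<Sum>t<j. \<Sum>i\<le>t. D_entry t i * coeff_perturbation u (j - 1 - t) i)"
proof -
  have "(\<Sum>i\<le>j. D_entry j i * path_sum u 0 i) = (\<Sum>i\<in>{..j} \<inter> {0}. D_entry j i)"
    by (simp add: if_distrib cong: if_cong)
  then show ?thesis using path_sum_telescope[of j j u] by simp
qed

lemma sum_odd_even_split:
  fixes f :: "nat \<Rightarrow> real"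
  shows "(\<Sum>i\<le>m. f (2 * i + 1) + (if i = 0 then 0 else f (2 * i))) = (\<Sum>s=1..2*m+1. f s)"
  by (induction m) (auto simp: algebra_simps numeral_eq_Suc)

lemma path_sum_tendsto:
  assumes "\<And>s. s \<ge> 1 \<Longrightarrow> (\<lambda>n. u n s) \<longlonglongrightarrow> v s"
  shows "(\<lambda>n. path_sum (u n) j i) \<longlonglongrightarrow> path_sum v j i"
proof (induction j arbitrary: i)
  case 0
  then show ?case by simp
next
  case (Suc j)
  show ?case
  proof (cases "i = 0")
    case True
    then show ?thesis by (auto intro!: tendsto_intros Suc assms)
  next
    case False
    then show ?thesis by (auto intro!: tendsto_intros Suc assms)
  qed
qed

text \<open>The matrix \<open>D\<close> is the derivative of the moments at the semicircle coefficients.  In the limit both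
  factors around the perturbation are ballot numbers, and \<open>D_entry_convolution\<close> sums them: the level
  weight \<open>u (2i + 1)\<close> receives \<open>D_entry j (2i + 1)\<close> and the down weight \<open>u (2i)\<close> receives
  \<open>D_entry j (2i)\<close>.\<close>

lemma moments_linearize:
  fixes c :: "nat \<Rightarrow> real" and u :: "nat \<Rightarrow> nat \<Rightarrow> real"
  assumes c: "filterlim c at_top sequentially"
    and u: "\<And>s. s \<ge> 1 \<Longrightarrow> (\<lambda>n. c n * (u n s - semicircle_coeffs s)) \<longlonglongrightarrow> z s"
  shows "(\<lambda>n. c n * (path_sum (u n) j 0 - D_entry j 0)) \<longlonglongrightarrow> (\<Sum>s=1..j. D_entry j s * z s)"
proof -
  have conv: "(\<lambda>n. u n s) \<longlonglongrightarrow> semicircle_coeffs s" if "s \<ge> 1" for s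
  proof -
    have "(\<lambda>n. inverse (c n) * (c n * (u n s - semicircle_coeffs s)) + semicircle_coeffs s)
        \<longlonglongrightarrow> 0 * z s + semicircle_coeffs s"
      using tendsto_inverse_0_at_top[OF c] u[OF that] by (intro tendsto_intros)
    moreover have "eventually (\<lambda>n. inverse (c n) * (c n * (u n s - semicircle_coeffs s))
        + semicircle_coeffs s = u n s) sequentially"
      using c[unfolded filterlim_at_top_dense, rule_format, of 0]
      by eventually_elim (simp add: field_simps)
    ultimately show ?thesis by (simp add: Lim_transform_eventually)
  qed
  then have T: "(\<lambda>n. path_sum (u n) l i) \<longlonglongrightarrow> D_entry l i" for l i
    unfolding path_sum_semicircle[symmetric] by (rule path_sum_tendsto) auto
  define P where "P l i = z (2 * i + 1) * D_entry l i +
     (if i = 0 then 0 else z (2 * i) * D_entry l (i - 1))" for l i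
  have P: "(\<lambda>n. c n * coeff_perturbation (u n) l i) \<longlonglongrightarrow> P l i" for l i
  proof (cases "i = 0")
    case True
    have "(\<lambda>n. c n * (u n (2 * i + 1) - semicircle_coeffs (2 * i + 1)) * path_sum (u n) l i) \<longlonglongrightarrow>
        z (2 * i + 1) * D_entry l i"
      by (intro tendsto_intros u T) auto
    then show ?thesis using True
      by (simp add: P_def coeff_perturbation_def semicircle_coeffs_def algebra_simps)
  next
    case False
    have "(\<lambda>n. c n * (u n (2 * i + 1) - semicircle_coeffs (2 * i + 1)) * path_sum (u n) l i +
         c n * (u n (2 * i) - semicircle_coeffs (2 * i)) * path_sum (u n) l (i - 1)) \<longlonglongrightarrow>
        z (2 * i + 1) * D_entry l i + z (2 * i) * D_entry l (i - 1)"
      using False by (intro tendsto_intros u T) auto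
    then show ?thesis using False
      by (simp add: P_def coeff_perturbation_def semicircle_coeffs_def algebra_simps)
  qed
  have "(\<lambda>n. (\<Sum>t<j. \<Sum>i\<le>t. D_entry t i * (c n * coeff_perturbation (u n) (j - 1 - t) i))) \<longlonglongrightarrow>
      (\<Sum>t<j. \<Sum>i\<le>t. D_entry t i * P (j - 1 - t) i)"
    by (intro tendsto_intros P)
  moreover have "(\<Sum>t<j. \<Sum>i\<le>t. D_entry t i * (c n * coeff_perturbation (u n) (j - 1 - t) i)) =
     c n * (path_sum (u n) j 0 - D_entry j 0)" for n
    unfolding path_sum_perturbation sum_distrib_left by (simp add: mult_ac)
  moreover have "(\<Sum>t<j. \<Sum>i\<le>t. D_entry t i * P (j - 1 - t) i) = (\<Sum>s=1..j. D_entry j s * z s)"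
  proof -
    have "(\<Sum>t<j. \<Sum>i\<le>t. D_entry t i * P (j - 1 - t) i) =
        (\<Sum>t<j. \<Sum>i\<le>j. D_entry t i * P (j - 1 - t) i)"
      by (intro sum.cong refl sum.mono_neutral_left) (auto simp: D_entry_eq_0)
    also have "\<dots> = (\<Sum>i\<le>j. \<Sum>t<j. D_entry t i * P (j - 1 - t) i)"
      by (rule sum.swap)
    also have "\<dots> = (\<Sum>i\<le>j. z (2 * i + 1) * (\<Sum>t<j. D_entry t i * D_entry (j - 1 - t) i) +
        (if i = 0 then 0 else z (2 * i) * (\<Sum>t<j. D_entry t i * D_entry (j - 1 - t) (i - 1))))"
      by (intro sum.cong refl)
         (auto simp: P_def sum_distrib_left sum.distrib algebra_simps)
    also have "\<dots> = (\<Sum>i\<le>j. z (2 * i + 1) * D_entry j (2 * i + 1) +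
        (if i = 0 then 0 else z (2 * i) * D_entry j (2 * i)))"
      unfolding D_entry_convolution by (intro sum.cong refl) (auto simp: mult_2)
    also have "\<dots> = (\<Sum>s=1..2*j+1. z s * D_entry j s)"
      by (rule sum_odd_even_split)
    also have "\<dots> = (\<Sum>s=1..j. z s * D_entry j s)"
      by (rule sum.mono_neutral_right) (auto simp: D_entry_eq_0)
    finally show ?thesis by (simp add: mult.commute)
  qed
  ultimately show ?thesis by simp
qed

section \<open>Moments of the semicircle law\<close>

definition semicircle_power_integral :: "nat \<Rightarrow> real" where
  "semicircle_power_integral i = integral {-2..2} (\<lambda>x. x ^ i * sqrt (4 - x\<^sup>2))"

lemma has_integral_semicircle_power:
  "((\<lambda>x. x ^ i * sqrt (4 - x\<^sup>2)) has_integral semicircle_power_integral i) {-2..2::real}"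
  unfolding semicircle_power_integral_def
  by (intro integrable_integral integrable_continuous_real continuous_intros)

lemma semicircle_sqrt_deriv:
  assumes "-2 < x" "x < (2::real)"
  shows "((\<lambda>x. sqrt (4 - x\<^sup>2)) has_real_derivative - x / sqrt (4 - x\<^sup>2)) (at x)"
    and "4 - x\<^sup>2 > 0"
proof -
  have "(2 - x) * (2 + x) > 0" using assms by (intro mult_pos_pos) auto
  then show pos: "4 - x\<^sup>2 > 0" by (simp add: algebra_simps power2_eq_square)
  show "((\<lambda>x. sqrt (4 - x\<^sup>2)) has_real_derivative - x / sqrt (4 - x\<^sup>2)) (at x)"
    using pos by (auto intro!: derivative_eq_intros simp: field_simps)
qed

text \<open>Integrate the derivative of \<open>x\<^sup>i (4 - x\<^sup>2)\<^bsup>3/2\<^esup>\<close>, which vanishes at both ends of the interval.\<close>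

lemma semicircle_power_integral_recurrence:
  "(real i + 3) * semicircle_power_integral (i + 1) = 4 * real i * semicircle_power_integral (i - 1)"
proof -
  define F where "F x = x ^ i * ((4 - x\<^sup>2) * sqrt (4 - x\<^sup>2))" for x :: real
  define f where "f x = 4 * real i * (x ^ (i - 1) * sqrt (4 - x\<^sup>2)) -
      (real i + 3) * (x ^ (i + 1) * sqrt (4 - x\<^sup>2))" for x :: real
  have ftc: "(f has_integral F 2 - F (-2)) {-2..2}"
  proof (rule fundamental_theorem_of_calculus_interior)
    show "continuous_on {-2..2} F"
      unfolding F_def by (intro continuous_intros)
    fix x :: real assume "x \<in> {-2<..<2}"
    then have x: "-2 < x" "x < 2" by auto
    note pos = semicircle_sqrt_deriv(2)[OF x]
    have "((\<lambda>x. (4 - x\<^sup>2) * sqrt (4 - x\<^sup>2)) has_real_derivative - 3 * x * sqrt (4 - x\<^sup>2)) (at x)"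
    proof -
      have "(- (2 * x)) * sqrt (4 - x\<^sup>2) + (- x / sqrt (4 - x\<^sup>2)) * (4 - x\<^sup>2) = - 3 * x * sqrt (4 - x\<^sup>2)"
      proof -
        define r where "r = sqrt (4 - x\<^sup>2)"
        have "r > 0" and r: "4 - x\<^sup>2 = r * r" using pos by (auto simp: r_def)
        then show ?thesis unfolding r_def[symmetric] by (simp add: r)
      qed
      moreover have "((\<lambda>x. (4 - x\<^sup>2) * sqrt (4 - x\<^sup>2)) has_real_derivative
          (- (2 * x)) * sqrt (4 - x\<^sup>2) + (- x / sqrt (4 - x\<^sup>2)) * (4 - x\<^sup>2)) (at x)"
        by (rule DERIV_mult[OF _ semicircle_sqrt_deriv(1)[OF x]]) (auto intro!: derivative_eq_intros)
      ultimately show ?thesis by (simp only:)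
    qed
    then have "(F has_real_derivative (real i * x ^ (i - 1)) * ((4 - x\<^sup>2) * sqrt (4 - x\<^sup>2)) +
         (- 3 * x * sqrt (4 - x\<^sup>2)) * x ^ i) (at x)"
      unfolding F_def by (intro DERIV_mult) (auto intro!: derivative_eq_intros)
    moreover have "(real i * x ^ (i - 1)) * ((4 - x\<^sup>2) * sqrt (4 - x\<^sup>2)) +
         (- 3 * x * sqrt (4 - x\<^sup>2)) * x ^ i = f x"
      by (cases i) (simp_all add: f_def algebra_simps power2_eq_square)
    ultimately show "(F has_vector_derivative f x) (at x)"
      by (simp add: has_real_derivative_iff_has_vector_derivative)
  qed auto
  have "F 2 - F (-2) = 0" by (simp add: F_def)
  moreover have "(f has_integral 4 * real i * semicircle_power_integral (i - 1) -
      (real i + 3) * semicircle_power_integral (i + 1)) {-2..2}"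
    unfolding f_def
    by (intro has_integral_diff has_integral_mult_right has_integral_semicircle_power)
  ultimately show ?thesis using has_integral_unique[OF ftc] by fastforce
qed

lemma semicircle_power_integral_0: "semicircle_power_integral 0 = 2 * pi"
proof -
  define F where "F x = x / 2 * sqrt (4 - x\<^sup>2) + 2 * arcsin (x / 2)" for x :: real
  have "((\<lambda>x. x ^ 0 * sqrt (4 - x\<^sup>2)) has_integral F 2 - F (-2)) {-2..2}"
  proof (rule fundamental_theorem_of_calculus_interior)
    show "continuous_on {-2..2} F"
      unfolding F_def by (intro continuous_intros) auto
    fix x :: real assume "x \<in> {-2<..<2}"
    then have x: "-2 < x" "x < 2" by auto
    note pos = semicircle_sqrt_deriv(2)[OF x]
    have sq: "sqrt (1 - (x / 2)\<^sup>2) = sqrt (4 - x\<^sup>2) / 2"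
    proof -
      have quarter: "1 - (x / 2)\<^sup>2 = (4 - x\<^sup>2) / 4" by (simp add: power_divide field_simps)
      show ?thesis unfolding quarter by (simp add: real_sqrt_divide)
    qed
    have "(F has_real_derivative (1 / 2 * sqrt (4 - x\<^sup>2) + (- x / sqrt (4 - x\<^sup>2)) * (x / 2)) +
        2 * (inverse (sqrt (1 - (x / 2)\<^sup>2)) * (1 / 2))) (at x)"
      unfolding F_def
      by (intro DERIV_add DERIV_mult DERIV_cmult DERIV_chain2[OF DERIV_arcsin] semicircle_sqrt_deriv[OF x])
         (use x in \<open>auto intro!: derivative_eq_intros\<close>)
    moreover have "(1 / 2 * sqrt (4 - x\<^sup>2) + (- x / sqrt (4 - x\<^sup>2)) * (x / 2)) +
        2 * (inverse (sqrt (1 - (x / 2)\<^sup>2)) * (1 / 2)) = sqrt (4 - x\<^sup>2)"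
    proof -
      define r where "r = sqrt (4 - x\<^sup>2)"
      have "r > 0" and "r * r = 4 - x * x" using pos by (auto simp: r_def power2_eq_square)
      then show ?thesis unfolding sq r_def[symmetric] by (simp add: field_simps)
    qed
    ultimately show "(F has_vector_derivative x ^ 0 * sqrt (4 - x\<^sup>2)) (at x)"
      by (simp add: has_real_derivative_iff_has_vector_derivative)
  qed auto
  then have "semicircle_power_integral 0 = F 2 - F (-2)"
    using has_integral_unique has_integral_semicircle_power by blast
  then show ?thesis by (simp add: F_def arcsin_minus)
qed

lemma semicircle_power_integral_eq: "semicircle_power_integral j = 2 * pi * D_entry j 0"
proof (induction j rule: less_induct)
  case (less j)
  show ?case
  proof (cases j)
    case 0
    then show ?thesis by (simp add: semicircle_power_integral_0 D_entry_0)
  next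
    case (Suc i)
    have "(real i + 3) * semicircle_power_integral (i + 1) =
        (real i + 3) * (2 * pi * D_entry (i + 1) 0)"
    proof (cases "i = 0")
      case True
      then show ?thesis
        using semicircle_power_integral_recurrence[of i] D_entry_column_0_recurrence[of i] by simp
    next
      case False
      then have "semicircle_power_integral (i - 1) = 2 * pi * D_entry (i - 1) 0"
        using less.IH[of "i - 1"] Suc by simp
      then show ?thesis
        using semicircle_power_integral_recurrence[of i] D_entry_column_0_recurrence[of i]
        by (simp add: mult.left_commute)
    qed
    then show ?thesis using Suc by simp
  qed
qed

lemma moment_semicircle: "moment semicircle j = D_entry j 0"
proof -
  have nn: "1 / (2 * pi) * sqrt (4 - x\<^sup>2) * indicator {-2<..<2} x \<ge> 0" for x :: real
    using semicircle_sqrt_deriv(2)[of x] by (auto simp: indicator_def)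
  have "moment semicircle j =
      (LINT x|lborel. (1 / (2 * pi) * sqrt (4 - x\<^sup>2) * indicator {-2<..<2} x) * x ^ j)"
    unfolding moment_def semicircle_def
    by (subst integral_real_density) (use nn in \<open>auto simp del: times_divide_eq_left\<close>)
  also have "\<dots> = (LINT x|lborel. 1 / (2 * pi) * (indicator {-2..2} x *\<^sub>R (x ^ j * sqrt (4 - x\<^sup>2))))"
  proof (intro Bochner_Integration.integral_cong refl)
    fix x :: real
    consider "x \<in> {-2<..<2}" | "x = 2" | "x = -2" | "x \<notin> {-2..2}" by fastforce
    then show "(1 / (2 * pi) * sqrt (4 - x\<^sup>2) * indicator {-2<..<2} x) * x ^ j =
        1 / (2 * pi) * (indicator {-2..2} x *\<^sub>R (x ^ j * sqrt (4 - x\<^sup>2)))"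
      by cases auto
  qed
  also have "\<dots> = 1 / (2 * pi) * (LBINT x:{-2..2}. x ^ j * sqrt (4 - x\<^sup>2))"
    by (simp add: set_lebesgue_integral_def)
  also have "(LBINT x:{-2..2}. x ^ j * sqrt (4 - x\<^sup>2)) = semicircle_power_integral j"
    unfolding semicircle_power_integral_def
    by (intro set_borel_integral_eq_integral borel_integrable_atLeastAtMost') 
       (auto intro!: continuous_intros)
  finally show ?thesis by (simp add: semicircle_power_integral_eq)
qed

section \<open>The moment map and its Jacobian\<close>

lemma path_sum_cong:
  assumes "\<And>s. 1 \<le> s \<Longrightarrow> s \<le> i + j \<Longrightarrow> u s = v s"
  shows "path_sum u j i = path_sum v j i"
  using assms
proof (induction j arbitrary: i)
  case 0
  then show ?case by simp
next
  case (Suc j)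
  have up: "path_sum u j (Suc i) = path_sum v j (Suc i)"
    and same: "path_sum u j i = path_sum v j i"
    and down: "path_sum u j (i - 1) = path_sum v j (i - 1)"
    by (rule Suc.IH; use Suc.prems in simp)+
  show ?case
  proof (cases "i \<le> j")
    case True
    then have "u (2 * i + 1) = v (2 * i + 1)" and "i \<noteq> 0 \<Longrightarrow> u (2 * i) = v (2 * i)"
      by (auto intro!: Suc.prems)
    then show ?thesis using up same down by simp
  next
    case False
    have zero: "path_sum w j l = 0" if "j < l" for w l
      using that by (induction j arbitrary: l) auto
    show ?thesis
    proof (cases "i = Suc j")
      case True
      then have "u (2 * i) = v (2 * i)" by (intro Suc.prems) auto
      then show ?thesis using True up down zero by simp
    next
      case False
      with \<open>\<not> i \<le> j\<close> show ?thesis by (simp add: zero)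
    qed
  qed
qed

lemma path_sum_eq_0: "j < i \<Longrightarrow> path_sum u j i = 0"
  by (induction j arbitrary: i) auto

lemma path_sum_diagonal: "path_sum u j j = (\<Prod>l=1..j. u (2 * l))"
  by (induction j) (auto simp: path_sum_eq_0 mult.commute)

definition leading_factor :: "(nat \<Rightarrow> real) \<Rightarrow> nat \<Rightarrow> real" where
  "leading_factor u s = (\<Prod>l=1..(s - 1) div 2. u (2 * l))"

lemma leading_factor_cong:
  "(\<And>t. 1 \<le> t \<Longrightarrow> t < s \<Longrightarrow> u t = v t) \<Longrightarrow> leading_factor u s = leading_factor v s"
  unfolding leading_factor_def by (intro prod.cong) auto

text \<open>A path from height \<open>i\<close> to \<open>0\<close> in \<open>j\<close> steps can use the variable \<open>u (i + j)\<close> only at the highest point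
  that it can reach, hence exactly once and followed by down steps only.  So \<open>path_sum u j i\<close> is affine
  in its last variable, with slope the product of the even-indexed variables before it.\<close>

lemma path_sum_last_variable:
  assumes "s = i + j" "s \<ge> 1"
  shows "path_sum u j i - path_sum (u(s := 0)) j i = (if i \<le> j then u s * leading_factor u s else 0)"
  using assms
proof (induction j arbitrary: i)
  case 0
  then show ?case by simp
next
  case (Suc j)
  define v where "v = u(s := 0)"
  have v: "v s = 0" "\<And>t. t \<noteq> s \<Longrightarrow> v t = u t" by (auto simp: v_def)
  have up: "path_sum u j (Suc i) - path_sum v j (Suc i) =
      (if Suc i \<le> j then u s * leading_factor u s else 0)"
    unfolding v_def using Suc.prems by (intro Suc.IH) auto
  have same: "path_sum v j i = path_sum u j i" and down: "path_sum v j (i - 1) = path_sum u j (i - 1)"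
    using Suc.prems by (auto intro!: path_sum_cong v)
  consider "i < j" | "i = j" | "i = Suc j" | "i > Suc j" by linarith
  then have "path_sum u (Suc j) i - path_sum v (Suc j) i =
      (if i \<le> Suc j then u s * leading_factor u s else 0)"
  proof cases
    case 1
    then show ?thesis using up Suc.prems same down v by auto
  next
    case 2
    then have "leading_factor u s = path_sum u j j"
      using Suc.prems by (simp add: leading_factor_def path_sum_diagonal)
    then show ?thesis using 2 up Suc.prems same down v by (auto simp: mult_2)
  next
    case 3
    then have "leading_factor u s = path_sum u j j"
      using Suc.prems by (simp add: leading_factor_def path_sum_diagonal)
    then show ?thesis using 3 up Suc.prems same down v by (auto simp: mult_2 path_sum_eq_0)
  next
    case 4
    then show ?thesis by (simp add: path_sum_eq_0)
  qed
  then show ?case by (simp only: v_def)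
qed

lemma moment_last_variable:
  "s \<ge> 1 \<Longrightarrow> path_sum u s 0 = path_sum (u(s := 0)) s 0 + leading_factor u s * u s"
  using path_sum_last_variable[of s 0 s u] by (simp add: diff_eq_eq mult.commute add.commute)

definition moment_map :: "nat \<Rightarrow> (nat \<Rightarrow> real) \<Rightarrow> nat \<Rightarrow> real" where
  "moment_map N u = (\<lambda>s\<in>{1..N}. path_sum u s 0)"

text \<open>The coefficient vectors with \<open>a\<^sub>k > 0\<close>.\<close>

definition admissible :: "nat \<Rightarrow> (nat \<Rightarrow> real) set" where
  "admissible N = {u. \<forall>l\<ge>1. 2 * l \<le> N \<longrightarrow> u (2 * l) > 0}"

lemma admissible_mono: "u \<in> admissible N \<Longrightarrow> M \<le> N \<Longrightarrow> u \<in> admissible M"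
  by (auto simp: admissible_def)

lemma leading_factor_pos: "u \<in> admissible N \<Longrightarrow> s \<le> Suc N \<Longrightarrow> leading_factor u s > 0"
  unfolding leading_factor_def admissible_def by (intro prod_pos) auto

text \<open>The moment map is triangular, and affine in the new variable; therefore one-dimensional affine
  substitutions suffice for the change of variables below.\<close>

lemma moment_map_Suc:
  "moment_map (Suc N) (u(Suc N := t)) = (moment_map N u)(Suc N :=
     path_sum (u(Suc N := 0)) (Suc N) 0 + leading_factor u (Suc N) * t)"
proof
  fix s
  consider "s = Suc N" | "s \<in> {1..N}" | "s \<noteq> Suc N" "s \<notin> {1..N}" by blast
  then show "moment_map (Suc N) (u(Suc N := t)) s = ((moment_map N u)(Suc N :=
     path_sum (u(Suc N := 0)) (Suc N) 0 + leading_factor u (Suc N) * t)) s"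
  proof cases
    case 1
    have "leading_factor (u(Suc N := t)) (Suc N) = leading_factor u (Suc N)"
      by (rule leading_factor_cong) auto
    then show ?thesis using 1 moment_last_variable[of "Suc N" "u(Suc N := t)"]
      by (simp add: moment_map_def del: path_sum.simps)
  next
    case 2
    then have "path_sum (u(Suc N := t)) s 0 = path_sum u s 0" by (intro path_sum_cong) auto
    then show ?thesis using 2 by (simp add: moment_map_def)
  next
    case 3
    then show ?thesis by (auto simp: moment_map_def)
  qed
qed

lemma moment_map_inj:
  assumes eq: "moment_map N u = moment_map N v" and u: "u \<in> admissible (N - 1)"
  shows "1 \<le> s \<Longrightarrow> s \<le> N \<Longrightarrow> u s = v s"
proof (induction s rule: less_induct)
  case (less s)
  then have low: "u t = v t" if "1 \<le> t" "t < s" for t using that by auto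
  have "path_sum u s 0 = path_sum v s 0"
    using fun_cong[OF eq, of s] less.prems by (simp add: moment_map_def)
  moreover have "path_sum (u(s := 0)) s 0 = path_sum (v(s := 0)) s 0"
    using low by (intro path_sum_cong) auto
  moreover have "leading_factor v s = leading_factor u s"
    using low by (intro leading_factor_cong) auto
  moreover have "leading_factor u s > 0"
    using less.prems by (intro leading_factor_pos[OF u]) auto
  ultimately show "u s = v s"
    using moment_last_variable[OF less.prems(1), of u] moment_last_variable[OF less.prems(1), of v]
    by simp
qed

abbreviation (input) lebesgue_upto :: "nat \<Rightarrow> (nat \<Rightarrow> real) measure" where
  "lebesgue_upto N \<equiv> \<Pi>\<^sub>M i\<in>{1..N}. lborel"

lemma measurable_PiM_lborel_coordinate [measurable]:
  "(\<lambda>u. u s) \<in> borel_measurable (\<Pi>\<^sub>M i\<in>I. (lborel :: real measure))"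
proof (cases "s \<in> I")
  case True
  then have "(\<lambda>u. u s) \<in> measurable (\<Pi>\<^sub>M i\<in>I. (lborel :: real measure)) lborel"
    by (rule measurable_component_singleton)
  then show ?thesis by simp
next
  case False
  then show ?thesis
    by (subst measurable_cong[where g = "\<lambda>_. undefined"])
       (auto simp: space_PiM PiE_def extensional_def)
qed

lemma measurable_path_sum_compose:
  assumes [measurable]: "\<And>t. (\<lambda>x. g x t) \<in> borel_measurable M"
  shows "(\<lambda>x. path_sum (g x) s i) \<in> borel_measurable M"
proof (induction s arbitrary: i)
  case (Suc s)
  note Suc.IH[measurable]
  show ?case by (cases "i = 0") simp_all
qed simp

lemma measurable_path_sum [measurable]:
  "(\<lambda>u. path_sum u j i) \<in> borel_measurable (\<Pi>\<^sub>M i\<in>I. lborel)"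
  by (rule measurable_path_sum_compose) simp

lemma measurable_moment_map [measurable]:
  "moment_map N \<in> measurable (lebesgue_upto N) (lebesgue_upto N)"
  unfolding moment_map_def by (rule measurable_restrict) simp

lemma measurable_leading_factor [measurable]:
  "(\<lambda>u. leading_factor u s) \<in> borel_measurable (\<Pi>\<^sub>M i\<in>I. lborel)"
  unfolding leading_factor_def by measurable

lemma measurable_admissible [measurable]:
  "Measurable.pred (\<Pi>\<^sub>M i\<in>I. lborel) (\<lambda>u. u \<in> admissible N)"
  unfolding admissible_def mem_Collect_eq by measurable

text \<open>The determinant of the triangular derivative of \<open>moment_map N\<close>.\<close>

definition jacobian :: "nat \<Rightarrow> (nat \<Rightarrow> real) \<Rightarrow> real" where
  "jacobian N u = (\<Prod>s=1..N. leading_factor u s)"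

lemma measurable_jacobian [measurable]:
  "jacobian N \<in> borel_measurable (\<Pi>\<^sub>M i\<in>I. lborel)"
  unfolding jacobian_def by measurable

lemma jacobian_nonneg: "u \<in> admissible N \<Longrightarrow> jacobian N u \<ge> 0"
  unfolding jacobian_def by (intro prod_nonneg less_imp_le[OF leading_factor_pos]) auto

lemma jacobian_Suc: "jacobian (Suc N) (u(Suc N := t)) = jacobian N u * leading_factor u (Suc N)"
proof -
  have "leading_factor (u(Suc N := t)) s = leading_factor u s" if "s \<le> Suc N" for s
    using that by (intro leading_factor_cong) auto
  then show ?thesis by (simp add: jacobian_def)
qed

text \<open>By induction on the dimension: Fubini splits off the last moment, the substitution in the last
  variable is affine, and the other variables are treated by the induction hypothesis.  The
  hypothesis on the support of \<open>f\<close> plays the part of a restriction of the integral to the image.\<close>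

lemma change_of_variables_moment_map:
  assumes "f \<in> borel_measurable (lebesgue_upto N)"
    and "\<And>m. m \<in> space (lebesgue_upto N) \<Longrightarrow> m \<notin> moment_map N ` admissible N \<Longrightarrow> f m = 0"
  shows "(\<integral>\<^sup>+ m. f m \<partial>lebesgue_upto N) =
     (\<integral>\<^sup>+ u. indicator (admissible N) u * f (moment_map N u) * ennreal (jacobian N u) \<partial>lebesgue_upto N)"
  using assms
proof (induction N arbitrary: f)
  case 0
  have "moment_map 0 u = (\<lambda>_. undefined)" for u by (simp add: moment_map_def restrict_def)
  then show ?case by (simp add: PiM_empty nn_integral_count_space_finite jacobian_def admissible_def)
next
  case (Suc N)
  interpret product_sigma_finite "\<lambda>_::nat. lborel :: real measure" by standard
  have ins: "{1..Suc N} = insert (Suc N) {1..N}" by auto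
  note f0 = Suc.prems(2)
  have f[measurable]: "f \<in> borel_measurable (\<Pi>\<^sub>M i\<in>insert (Suc N) {1..N}. lborel)"
    using Suc.prems(1) unfolding ins .
  have upd: "x(Suc N := y) \<in> space (lebesgue_upto (Suc N))" if "x \<in> space (lebesgue_upto N)" for x y
    using that by (auto simp: space_PiM PiE_def extensional_def)
  define F where "F x = (\<integral>\<^sup>+ y. f (x(Suc N := y)) \<partial>lborel)" for x
  have F_meas: "F \<in> borel_measurable (lebesgue_upto N)"
    unfolding F_def by measurable
  have slice: "(\<lambda>y. f (x(Suc N := y))) \<in> borel_measurable borel"
    if "x \<in> space (lebesgue_upto N)" for x
  proof -
    have "(\<lambda>y. x(Suc N := y)) \<in> measurable lborel (\<Pi>\<^sub>M i\<in>insert (Suc N) {1..N}. lborel)"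
      using that by (intro measurable_component_update) auto
    from measurable_compose[OF this f] show ?thesis by simp
  qed
  have F_0: "F m = 0" if m: "m \<in> space (lebesgue_upto N)" "m \<notin> moment_map N ` admissible N" for m
  proof -
    have "f (m(Suc N := y)) = 0" for y
    proof (rule f0[OF upd[OF m(1)]], rule notI)
      assume "m(Suc N := y) \<in> moment_map (Suc N) ` admissible (Suc N)"
      then obtain v where v: "v \<in> admissible (Suc N)" "m(Suc N := y) = moment_map (Suc N) v" by auto
      have "m = moment_map N v"
      proof
        fix s show "m s = moment_map N v s"
          using fun_cong[OF v(2), of s] m(1)
          by (cases "s = Suc N")
             (auto simp: moment_map_def space_PiM PiE_def extensional_def split: if_splits)
      qed
      with v(1) m(2) show False using admissible_mono[of v "Suc N" N] by auto
    qed
    then show ?thesis by (simp add: F_def)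
  qed
  have "(\<integral>\<^sup>+ m. f m \<partial>lebesgue_upto (Suc N)) = (\<integral>\<^sup>+ x. F x \<partial>lebesgue_upto N)"
    unfolding ins F_def by (rule product_nn_integral_insert[OF _ _ f]) simp_all
  also have "\<dots> = (\<integral>\<^sup>+ u. indicator (admissible N) u * F (moment_map N u) * ennreal (jacobian N u)
      \<partial>lebesgue_upto N)"
    by (rule Suc.IH[OF F_meas F_0])
  also have "\<dots> = (\<integral>\<^sup>+ u. (\<integral>\<^sup>+ t. indicator (admissible (Suc N)) (u(Suc N := t)) *
        f (moment_map (Suc N) (u(Suc N := t))) * ennreal (jacobian (Suc N) (u(Suc N := t))) \<partial>lborel)
      \<partial>lebesgue_upto N)"
  proof (rule nn_integral_cong)
    fix u assume u: "u \<in> space (lebesgue_upto N)"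
    show "indicator (admissible N) u * F (moment_map N u) * ennreal (jacobian N u) =
      (\<integral>\<^sup>+ t. indicator (admissible (Suc N)) (u(Suc N := t)) *
        f (moment_map (Suc N) (u(Suc N := t))) * ennreal (jacobian (Suc N) (u(Suc N := t))) \<partial>lborel)"
    proof (cases "u \<in> admissible N")
      case False
      have "u(Suc N := t) \<notin> admissible (Suc N)" for t
      proof
        assume t: "u(Suc N := t) \<in> admissible (Suc N)"
        have "u (2 * l) > 0" if "l \<ge> 1" "2 * l \<le> N" for l
        proof -
          have "(u(Suc N := t)) (2 * l) > 0" using t that by (simp add: admissible_def del: fun_upd_apply)
          then show ?thesis using that by (simp split: if_splits)
        qed
        with False show False by (simp add: admissible_def)
      qed
      then show ?thesis using False by simp
    next
      case adm: True
      define C where "C = leading_factor u (Suc N)"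
      define R where "R = path_sum (u(Suc N := 0)) (Suc N) 0"
      have C: "C > 0" unfolding C_def using adm by (rule leading_factor_pos) simp
      have J: "jacobian N u \<ge> 0" using adm by (rule jacobian_nonneg)
      have mm: "moment_map N u \<in> space (lebesgue_upto N)"
        using measurable_space[OF measurable_moment_map u] .
      \<comment> \<open>If \<open>Suc N\<close> is even then the last variable has to be positive.  For \<open>t \<le> 0\<close> the point lies
        outside the image, because the moment map is injective, and so \<open>f\<close> vanishes there.\<close>
      have integrand: "indicator (admissible (Suc N)) (u(Suc N := t)) *
          f (moment_map (Suc N) (u(Suc N := t))) = f (moment_map (Suc N) (u(Suc N := t)))" for t
      proof (cases "u(Suc N := t) \<in> admissible (Suc N)")
        case False
        have "moment_map (Suc N) (u(Suc N := t)) \<notin> moment_map (Suc N) ` admissible (Suc N)"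
        proof
          assume "moment_map (Suc N) (u(Suc N := t)) \<in> moment_map (Suc N) ` admissible (Suc N)"
          then obtain v where v: "v \<in> admissible (Suc N)"
            "moment_map (Suc N) v = moment_map (Suc N) (u(Suc N := t))" by auto
          have "v s = (u(Suc N := t)) s" if "1 \<le> s" "s \<le> Suc N" for s
            using v(1) that by (intro moment_map_inj[OF v(2)]) (auto simp: admissible_def)
          then have "u(Suc N := t) \<in> admissible (Suc N)"
            using v(1) by (auto simp: admissible_def simp del: fun_upd_apply)
          with False show False by simp
        qed
        moreover have "moment_map (Suc N) (u(Suc N := t)) \<in> space (lebesgue_upto (Suc N))"
          unfolding moment_map_Suc by (rule upd[OF mm])
        ultimately have "f (moment_map (Suc N) (u(Suc N := t))) = 0"
          by (intro f0)
        then show ?thesis by simp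
      qed auto
      have "F (moment_map N u) = ennreal C * (\<integral>\<^sup>+ t. f ((moment_map N u)(Suc N := R + C * t)) \<partial>lborel)"
        unfolding F_def using slice[OF mm] C
        by (subst nn_integral_real_affine[where c = C and t = R]) auto
      then have "indicator (admissible N) u * F (moment_map N u) * ennreal (jacobian N u) =
          (\<integral>\<^sup>+ t. f (moment_map (Suc N) (u(Suc N := t))) \<partial>lborel) * ennreal (jacobian N u * C)"
        using adm C J by (simp add: moment_map_Suc R_def C_def ennreal_mult mult_ac)
      also have "\<dots> = (\<integral>\<^sup>+ t. f (moment_map (Suc N) (u(Suc N := t))) * ennreal (jacobian N u * C) \<partial>lborel)"
      proof (rule nn_integral_multc[symmetric])
        have "(\<lambda>t. R + C * t) \<in> measurable lborel borel" by simp
        from measurable_compose[OF this slice[OF mm]]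
        show "(\<lambda>t. f (moment_map (Suc N) (u(Suc N := t)))) \<in> borel_measurable lborel"
          by (simp add: moment_map_Suc R_def C_def)
      qed
      finally show ?thesis by (simp only: integrand jacobian_Suc C_def)
    qed
  qed
  also have "\<dots> = (\<integral>\<^sup>+ u. indicator (admissible (Suc N)) u * f (moment_map (Suc N) u) *
       ennreal (jacobian (Suc N) u) \<partial>lebesgue_upto (Suc N))"
  proof -
    note Suc.prems(1)[measurable]
    have meas: "(\<lambda>u. indicator (admissible (Suc N)) u * f (moment_map (Suc N) u) *
        ennreal (jacobian (Suc N) u)) \<in> borel_measurable (lebesgue_upto (Suc N))"
      by measurable
    show ?thesis
      unfolding ins by (rule product_nn_integral_insert[OF _ _ meas[unfolded ins], symmetric]) simp_all
  qed
  finally show ?case .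
qed

section \<open>Recursion coefficients of an interior moment vector\<close>

lemma integrable_poly:
  assumes "\<mu> \<in> prob_all_moments"
  shows "integrable \<mu> (poly p)"
proof -
  have "integrable \<mu> (\<lambda>x. \<Sum>i\<le>degree p. coeff p i * x ^ i)"
    using assms by (auto simp: prob_all_moments_def)
  then show ?thesis by (simp add: poly_altdef[abs_def])
qed

lemma integral_poly_eq_moments:
  assumes "\<mu> \<in> prob_all_moments" "degree p \<le> d"
  shows "(LINT x|\<mu>. poly p x) = (\<Sum>i\<le>d. coeff p i * moment \<mu> i)"
proof -
  have "poly p x = (\<Sum>i\<le>d. coeff p i * x ^ i)" for x
    unfolding poly_altdef using assms(2)
    by (intro sum.mono_neutral_left) (auto simp: coeff_eq_0)
  then have "(LINT x|\<mu>. poly p x) = (LINT x|\<mu>. (\<Sum>i\<le>d. coeff p i * x ^ i))" by simp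
  also have "\<dots> = (\<Sum>i\<le>d. LINT x|\<mu>. coeff p i * x ^ i)"
    using assms(1) by (intro Bochner_Integration.integral_sum) (auto simp: prob_all_moments_def)
  finally show ?thesis by (simp add: moment_def)
qed

lemma moment_0: "\<mu> \<in> prob_all_moments \<Longrightarrow> moment \<mu> 0 = 1"
  by (simp add: prob_all_moments_def moment_def prob_space.prob_space)

lemma interior_moment_space_decrease:
  assumes m: "m \<in> interior_moment_space N" and d: "d \<in> {1..N}"
  obtains \<epsilon> where "\<epsilon> > 0" "m(d := m d - \<epsilon>) \<in> moment_space N"
proof -
  let ?T = "product_topology (\<lambda>_. euclideanreal) {1..N}"
  define \<Omega> where "\<Omega> = interior_moment_space N"
  have op: "openin ?T \<Omega>" by (simp add: \<Omega>_def interior_moment_space_def)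
  have sub: "\<Omega> \<subseteq> moment_space N"
    by (simp add: \<Omega>_def interior_moment_space_def interior_of_subset)
  have ext: "m \<in> extensional {1..N}"
    using m sub by (auto simp: \<Omega>_def moment_space_def)
  have "continuous_map euclideanreal ?T (\<lambda>t. m(d := m d - t))"
    unfolding continuous_map_componentwise
  proof (intro conjI ballI)
    show "(\<lambda>t. m(d := m d - t)) ` topspace euclideanreal \<subseteq> extensional {1..N}"
      using ext d by (auto simp: extensional_def)
    show "continuous_map euclideanreal euclideanreal (\<lambda>t. (m(d := m d - t)) k)" for k
      by (cases "k = d") (auto intro!: continuous_intros)
  qed
  then have "openin euclideanreal {t \<in> topspace euclideanreal. m(d := m d - t) \<in> \<Omega>}"
    using op by (rule openin_continuous_map_preimage)
  then have "open {t. m(d := m d - t) \<in> \<Omega>}" by simp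
  moreover have "0 \<in> {t. m(d := m d - t) \<in> \<Omega>}" using m by (simp add: \<Omega>_def)
  ultimately obtain e where e: "e > 0" "ball 0 e \<subseteq> {t. m(d := m d - t) \<in> \<Omega>}"
    unfolding open_contains_ball by blast
  have "e / 2 \<in> ball (0::real) e" using e(1) by (simp add: dist_norm)
  then have "m(d := m d - e / 2) \<in> moment_space N" using e(2) sub by blast
  then show ?thesis using that e(1) by (metis half_gt_zero)
qed

text \<open>If \<open>\<integral> p\<^sup>2 d\<mu> = 0\<close>, then lowering the moment of order \<open>2 deg p\<close>, which has a positive coefficient in
  \<open>p\<^sup>2\<close>, would produce a measure with a negative integral of \<open>p\<^sup>2\<close>.\<close>

lemma integral_square_pos:
  assumes m: "m \<in> interior_moment_space N"
    and mu: "\<mu> \<in> prob_all_moments" "\<And>i. i \<in> {1..N} \<Longrightarrow> moment \<mu> i = m i"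
    and p: "p \<noteq> 0" "2 * degree p \<le> N"
  shows "(LINT x|\<mu>. poly (p * p) x) > 0"
proof (cases "degree p = 0")
  case True
  then obtain c where c: "p = [:c:]" by (rule degree_eq_zeroE)
  with p have "c \<noteq> 0" by simp
  then show ?thesis using mu(1) c
    by (auto simp: prob_all_moments_def prob_space.prob_space zero_less_mult_iff)
next
  case False
  define d where "d = 2 * degree p"
  have d: "degree (p * p) = d" using p by (simp add: degree_mult_eq d_def)
  have lc: "coeff (p * p) d > 0"
  proof -
    have "lead_coeff p \<noteq> 0" using p by simp
    then have "0 < lead_coeff p * lead_coeff p" by (metis not_real_square_gt_zero)
    then show ?thesis using d lead_coeff_mult[of p p] by simp
  qed
  have dN: "d \<in> {1..N}" using False p by (simp add: d_def)
  obtain \<epsilon> where eps: "\<epsilon> > 0" "m(d := m d - \<epsilon>) \<in> moment_space N"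
    using interior_moment_space_decrease[OF m dN] .
  then obtain \<nu> where nu: "\<nu> \<in> prob_all_moments"
    "(m(d := m d - \<epsilon>)) = (\<lambda>i\<in>{1..N}. moment \<nu> i)"
    by (auto simp: moment_space_def)
  have nu_m: "moment \<nu> i = (if i = d then moment \<mu> i - \<epsilon> else moment \<mu> i)" if "i \<le> d" for i
  proof (cases "i = 0")
    case True
    then show ?thesis using dN nu(1) mu(1) by (simp add: moment_0)
  next
    case False
    then have "i \<in> {1..N}" using that dN by auto
    then show ?thesis using fun_cong[OF nu(2), of i] mu(2)[of i] mu(2)[OF dN] by (auto split: if_splits)
  qed
  have "0 \<le> (LINT x|\<nu>. poly (p * p) x)" by (rule Bochner_Integration.integral_nonneg) simp
  also have "\<dots> = (\<Sum>i\<le>d. coeff (p * p) i * moment \<nu> i)"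
    by (rule integral_poly_eq_moments[OF nu(1)]) (simp add: d)
  also have "\<dots> = (\<Sum>i\<le>d. coeff (p * p) i * moment \<mu> i - (if i = d then coeff (p * p) d * \<epsilon> else 0))"
    by (rule sum.cong) (auto simp: nu_m algebra_simps)
  also have "\<dots> = (LINT x|\<mu>. poly (p * p) x) - coeff (p * p) d * \<epsilon>"
    by (subst integral_poly_eq_moments[OF mu(1), of _ d]) (simp_all add: d sum_subtractf)
  finally show ?thesis using mult_pos_pos[OF lc eps(1)] by linarith
qed

text \<open>The integral against a measure with the given moments, reduced to what the construction of the
  orthogonal polynomials \<open>P\<^sub>0, \<dots>, P\<^sub>n\<close> uses: positivity on the squares of degree less than \<open>2n\<close>.\<close>

locale positive_functional =
  fixes L :: "real poly \<Rightarrow> real" and n :: nat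
  assumes L_add: "L (p + q) = L p + L q"
    and L_smult: "L (Polynomial.smult c p) = c * L p"
    and L_1: "L 1 = 1"
    and L_square: "p \<noteq> 0 \<Longrightarrow> degree p < n \<Longrightarrow> L (p * p) > 0"
begin

abbreviation X :: "real poly" where "X \<equiv> [:0, 1:]"

definition \<beta> :: "real poly \<Rightarrow> real" where "\<beta> p = L (X * p * p) / L (p * p)"

definition \<alpha> :: "real poly \<Rightarrow> real poly \<Rightarrow> real" where "\<alpha> p q = L (p * p) / L (q * q)"

text \<open>The Stieltjes procedure: the recursion coefficients are the quotients that make the next polynomial
  orthogonal to the two preceding ones.\<close>

fun P :: "nat \<Rightarrow> real poly" where
  "P 0 = 1"
| "P (Suc 0) = X - Polynomial.smult (\<beta> 1) 1"
| "P (Suc (Suc k)) = X * P (Suc k) - Polynomial.smult (\<beta> (P (Suc k))) (P (Suc k)) -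
     Polynomial.smult (\<alpha> (P (Suc k)) (P k)) (P k)"

definition jacobi_coeffs :: "nat \<Rightarrow> real" where
  "jacobi_coeffs s = (if odd s then \<beta> (P (s div 2)) else \<alpha> (P (s div 2)) (P (s div 2 - 1)))"

lemma jacobi_coeffs_odd: "jacobi_coeffs (2 * k + 1) = \<beta> (P k)"
  and jacobi_coeffs_even: "jacobi_coeffs (2 * k) = \<alpha> (P k) (P (k - 1))"
  by (auto simp: jacobi_coeffs_def)

lemma three_term:
  "X * P k = P (Suc k) + Polynomial.smult (jacobi_coeffs (2 * k + 1)) (P k) +
     (if k = 0 then 0 else Polynomial.smult (jacobi_coeffs (2 * k)) (P (k - 1)))"
  unfolding jacobi_coeffs_odd jacobi_coeffs_even by (cases k) auto

lemma L_diff: "L (p - q) = L p - L q"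
  using L_add[of "p - q" q] by simp

lemma L_0: "L 0 = 0"
  using L_smult[of 0 0] by simp

lemma monic: "degree (P k) = k \<and> coeff (P k) k = 1"
proof -
  have "degree (P k) \<le> k \<and> coeff (P k) k = 1"
  proof (induction k rule: P.induct)
    case (3 k)
    have "degree (P (Suc (Suc k))) \<le> Suc (Suc k)"
    proof (rule degree_le, intro allI impI)
      fix i assume i: "Suc (Suc k) < i"
      then obtain j where "i = Suc j" by (cases i) auto
      with i 3 show "coeff (P (Suc (Suc k))) i = 0" by (simp add: coeff_eq_0)
    qed
    moreover have "coeff (P (Suc (Suc k))) (Suc (Suc k)) = 1"
      using 3 by (simp add: coeff_eq_0)
    ultimately show ?case by blast
  qed auto
  moreover from this have "degree (P k) \<ge> k" by (intro le_degree) simp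
  ultimately show ?thesis by auto
qed

lemma P_nonzero: "P k \<noteq> 0"
  using monic[of k] by force

lemma L_P_square: "k < n \<Longrightarrow> L (P k * P k) > 0"
  using L_square[OF P_nonzero] monic by simp

text \<open>Multiplication by \<open>X\<close> is symmetric for \<open>L\<close>.  Hence \<open>X P\<^sub>k\<close> is orthogonal to \<open>P\<^sub>j\<close> for \<open>j < k - 1\<close>
  because \<open>X P\<^sub>j\<close> is a combination of polynomials of index less than \<open>k\<close>, and the two remaining cases are
  the choices of the coefficients.\<close>

lemma orthogonal_less: "k \<le> n \<Longrightarrow> j < k \<Longrightarrow> L (P j * P k) = 0"
proof (induction k arbitrary: j rule: less_induct)
  case (less k)
  consider "k = 1" | l where "k = Suc (Suc l)" using less.prems
    by (metis One_nat_def not0_implies_Suc not_less_zero)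
  then show ?case
  proof cases
    case 1
    have "L (P 0 * P (Suc 0)) = L X - \<beta> 1 * L 1"
      by (simp only: P.simps mult_1 L_diff L_smult)
    moreover have "\<beta> 1 = L X" by (simp add: \<beta>_def L_1)
    ultimately show ?thesis using less.prems 1 by (simp add: L_1 del: P.simps)
  next
    case 2
    have IH: "L (P i * P l') = 0" if "i < l'" "l' \<le> Suc l" for i l'
      using less.IH[of l' i] less.prems 2 that by simp
    have pos: "L (P i * P i) > 0" if "i \<le> Suc l" for i
      using L_P_square[of i] that less.prems 2 by simp
    have "P j * P k = X * P j * P (Suc l) - Polynomial.smult (\<beta> (P (Suc l))) (P j * P (Suc l)) -
        Polynomial.smult (\<alpha> (P (Suc l)) (P l)) (P j * P l)"
      unfolding 2 P.simps by (simp add: algebra_simps)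
    then have exp: "L (P j * P k) = L (X * P j * P (Suc l)) - \<beta> (P (Suc l)) * L (P j * P (Suc l)) -
        \<alpha> (P (Suc l)) (P l) * L (P j * P l)"
      by (simp only: L_diff L_smult)
    have Xj: "L (X * P j * P (Suc l)) = L (P (Suc j) * P (Suc l)) +
       jacobi_coeffs (2 * j + 1) * L (P j * P (Suc l)) +
       (if j = 0 then 0 else jacobi_coeffs (2 * j) * L (P (j - 1) * P (Suc l)))"
      unfolding three_term by (simp add: distrib_right L_add L_smult L_0 del: P.simps)
    consider "j = Suc l" | "j = l" | "j < l" using less.prems 2 by linarith
    then show ?thesis
    proof cases
      case 1
      have "L (P j * P l) = 0" using IH[of l "Suc l"] 1 by (simp add: mult.commute del: P.simps)
      then show ?thesis using pos[of "Suc l"] exp unfolding 1 \<beta>_def by (simp del: P.simps)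
    next
      case 2
      then show ?thesis using pos[of l] IH[of l "Suc l"] IH[of "l - 1" "Suc l"]
        unfolding exp Xj by (simp add: \<alpha>_def L_0 del: P.simps)
    next
      case 3
      then show ?thesis using IH[of j "Suc l"] IH[of "j - 1" "Suc l"] IH[of "Suc j" "Suc l"] IH[of j l]
        unfolding exp Xj by (simp add: L_0 del: P.simps)
    qed
  qed
qed

lemma orthogonal: "j \<le> n \<Longrightarrow> k \<le> n \<Longrightarrow> j \<noteq> k \<Longrightarrow> L (P j * P k) = 0"
  using orthogonal_less[of j k] orthogonal_less[of k j] by (cases "j < k") (auto simp: mult.commute)

lemma orthogonal_lower_degree:
  "degree q \<le> d \<Longrightarrow> d < k \<Longrightarrow> k \<le> n \<Longrightarrow> L (q * P k) = 0"
proof (induction d arbitrary: q)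
  case 0
  then obtain c where "q = [:c:]" by (auto elim: degree_eq_zeroE)
  then have "q = Polynomial.smult c (P 0)" by simp
  then show ?case using 0 orthogonal_less[of k 0] by (simp only: mult_smult_left L_smult)
next
  case (Suc d)
  define r where "r = q - Polynomial.smult (coeff q (Suc d)) (P (Suc d))"
  have "degree r \<le> d"
  proof (rule degree_le, intro allI impI)
    fix i assume "d < i"
    then consider "i = Suc d" | "i > Suc d" by linarith
    then show "coeff r i = 0"
      using Suc.prems monic[of "Suc d"] by cases (auto simp: r_def coeff_eq_0)
  qed
  then have "L (r * P k) = 0" using Suc by simp
  moreover have "L (P (Suc d) * P k) = 0" using Suc.prems by (intro orthogonal_less) auto
  ultimately show ?case
    by (simp add: r_def left_diff_distrib L_diff L_smult del: P.simps)
qed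

text \<open>The three-term relation for \<open>X P\<^sub>k\<close> is the first-step recurrence of \<open>path_sum\<close>.  When it raises the
  index to \<open>n\<close>, where the relation ends, the exponent is less than \<open>n\<close> and both sides vanish.\<close>

lemma moment_eq_path_sum:
  "k < n \<Longrightarrow> j + k \<le> 2 * n - 1 \<Longrightarrow> L (X ^ j * P k) = path_sum jacobi_coeffs j k"
proof (induction j arbitrary: k)
  case 0
  then show ?case using orthogonal_less[of k 0] by (cases "k = 0") (auto simp: L_1 L_0)
next
  case (Suc j)
  have "X ^ Suc j * P k = X ^ j * (X * P k)" by (simp add: mult_ac)
  also have "L \<dots> = L (X ^ j * P (Suc k)) + jacobi_coeffs (2 * k + 1) * L (X ^ j * P k) +
     (if k = 0 then 0 else jacobi_coeffs (2 * k) * L (X ^ j * P (k - 1)))"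
    unfolding three_term by (simp add: distrib_left L_add L_smult L_0 del: P.simps)
  also have "L (X ^ j * P (Suc k)) = path_sum jacobi_coeffs j (Suc k)"
  proof (cases "Suc k < n")
    case True
    then show ?thesis using Suc by simp
  next
    case False
    then have "Suc k = n" "j < n" using Suc.prems by auto
    then show ?thesis
      using orthogonal_lower_degree[of "X ^ j" j n] by (simp add: degree_power_eq path_sum_eq_0 del: P.simps)
  qed
  also have "L (X ^ j * P k) = path_sum jacobi_coeffs j k" using Suc by simp
  finally show ?case using Suc by (cases "k = 0") simp_all
qed

lemma jacobi_coeffs_admissible: "jacobi_coeffs \<in> admissible (2 * n - 1)"
  unfolding admissible_def mem_Collect_eq jacobi_coeffs_even \<alpha>_def
  by (intro allI impI divide_pos_pos L_P_square) auto

text \<open>Pairing the recurrence with \<open>P\<^sub>k\<close> and with \<open>P\<^bsub>k-1\<^esub>\<close> determines both coefficients, and then the next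
  polynomial.\<close>

lemma recursion_unique:
  assumes Q: "\<And>k. k \<le> n \<Longrightarrow> degree (Q k) = k \<and> coeff (Q k) k = 1"
    and orth: "\<And>j k. j \<le> n \<Longrightarrow> k \<le> n \<Longrightarrow> j \<noteq> k \<Longrightarrow> L (Q j * Q k) = 0"
    and Q1: "Q 1 = [:- b 1, 1:]"
    and rec: "\<And>k. k \<in> {1..n-1} \<Longrightarrow> X * Q k =
        Q (k + 1) + Polynomial.smult (b (k + 1)) (Q k) + Polynomial.smult (a k) (Q (k - 1))"
    and n: "n \<ge> 1"
  shows "k < n \<Longrightarrow> b (k + 1) = jacobi_coeffs (2 * k + 1)"
    and "1 \<le> k \<Longrightarrow> k < n \<Longrightarrow> a k = jacobi_coeffs (2 * k)"
proof -
  have Q0: "Q 0 = 1"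
    using Q[of 0] by (metis degree_eq_zeroE le0 coeff_pCons_0 one_pCons)
  define c where "c k = (if k = 0 then 0 else a k)" for k
  have rec': "X * Q k = Q (Suc k) + Polynomial.smult (b (k + 1)) (Q k) + Polynomial.smult (c k) (Q (k - 1))"
    if "k < n" for k
  proof (cases "k = 0")
    case True
    then show ?thesis using Q0 Q1 by (simp add: c_def)
  next
    case False
    then show ?thesis using rec[of k] that by (simp add: c_def)
  qed
  have three: "X * P k = P (Suc k) + Polynomial.smult (jacobi_coeffs (2 * k + 1)) (P k) +
     Polynomial.smult (if k = 0 then 0 else jacobi_coeffs (2 * k)) (P (k - 1))" for k
    using three_term[of k] by simp
  have step: "b (k + 1) = jacobi_coeffs (2 * k + 1) \<and>
      (k \<noteq> 0 \<longrightarrow> c k = jacobi_coeffs (2 * k)) \<and> Q (Suc k) = P (Suc k)"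
    if k: "k < n" and Qk: "Q k = P k" and Qk1: "Q (k - 1) = P (k - 1)" for k
  proof -
    have pos: "L (P k * P k) > 0" using k by (rule L_P_square)
    have oQ: "L (Q (Suc k) * P k) = 0" using orth[of "Suc k" k] k Qk by simp
    have oP: "L (P (Suc k) * P k) = 0" using orthogonal[of "Suc k" k] k by simp
    have oQ1: "k \<noteq> 0 \<Longrightarrow> L (Q (Suc k) * P (k - 1)) = 0" using orth[of "Suc k" "k - 1"] k Qk1 by simp
    have oP1: "k \<noteq> 0 \<Longrightarrow> L (P (Suc k) * P (k - 1)) = 0" using orthogonal[of "Suc k" "k - 1"] k by simp
    have kk1: "k \<noteq> 0 \<Longrightarrow> L (P (k - 1) * P k) = 0" "k \<noteq> 0 \<Longrightarrow> L (P k * P (k - 1)) = 0"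
      using orthogonal[of "k - 1" k] orthogonal[of k "k - 1"] k by simp_all
    have eq: "Q (Suc k) + Polynomial.smult (b (k + 1)) (P k) + Polynomial.smult (c k) (P (k - 1)) =
       P (Suc k) + Polynomial.smult (jacobi_coeffs (2 * k + 1)) (P k) +
       Polynomial.smult (if k = 0 then 0 else jacobi_coeffs (2 * k)) (P (k - 1))"
      using rec'[OF k] three[of k] Qk Qk1 by simp
    from arg_cong[OF eq, of "\<lambda>p. L (p * P k)"]
    have "b (k + 1) * L (P k * P k) = jacobi_coeffs (2 * k + 1) * L (P k * P k)"
      using kk1 oQ oP by (cases "k = 0")
        (simp_all add: distrib_right L_add L_smult c_def del: P.simps)
    then have b: "b (k + 1) = jacobi_coeffs (2 * k + 1)" using pos by simp
    have a: "c k = jacobi_coeffs (2 * k)" if "k \<noteq> 0"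
    proof -
      have "L (P (k - 1) * P (k - 1)) > 0" using k by (intro L_P_square) simp
      moreover from arg_cong[OF eq, of "\<lambda>p. L (p * P (k - 1))"]
      have "c k * L (P (k - 1) * P (k - 1)) = jacobi_coeffs (2 * k) * L (P (k - 1) * P (k - 1))"
        using that kk1 oQ1 oP1 by (simp add: distrib_right L_add L_smult del: P.simps)
      ultimately show ?thesis by simp
    qed
    have "Q (Suc k) = P (Suc k)"
      using eq a b by (cases "k = 0") (simp_all add: c_def del: P.simps)
    then show ?thesis using a b by blast
  qed
  have QP: "k \<le> n \<longrightarrow> Q k = P k" for k
  proof (induction k rule: less_induct)
    case (less k)
    show ?case
    proof (cases k)
      case 0
      then show ?thesis using Q0 by simp
    next
      case (Suc l)
      then show ?thesis using less.IH[of l] less.IH[of "l - 1"] step[of l] by auto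
    qed
  qed
  show "k < n \<Longrightarrow> b (k + 1) = jacobi_coeffs (2 * k + 1)"
    using step[of k] QP[of k] QP[of "k - 1"] by simp
  show "1 \<le> k \<Longrightarrow> k < n \<Longrightarrow> a k = jacobi_coeffs (2 * k)"
    using step[of k] QP[of k] QP[of "k - 1"] by (simp add: c_def)
qed

end

text \<open>The interior of the moment space lies in the image of the admissible coefficient vectors, and the
  preimage is given by \<^const>\<open>rec_b\<close> and \<^const>\<open>rec_a\<close>.\<close>

lemma interior_moment_space_recursion:
  assumes n: "n \<ge> 1" and m: "m \<in> interior_moment_space (2 * n - 1)"
  obtains u where "u \<in> admissible (2 * n - 1)" "m = moment_map (2 * n - 1) u"
    "\<And>k. k \<in> {1..n} \<Longrightarrow> rec_b n m k = u (2 * k - 1)"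
    "\<And>k. k \<in> {1..n-1} \<Longrightarrow> rec_a n m k = u (2 * k)"
proof -
  have "m \<in> moment_space (2 * n - 1)"
    using m unfolding interior_moment_space_def by (rule interior_of_subset[THEN subsetD])
  then obtain \<mu> where mu: "\<mu> \<in> prob_all_moments" and mdef: "m = (\<lambda>i\<in>{1..2*n-1}. moment \<mu> i)"
    by (auto simp: moment_space_def)
  have mm: "moment \<mu> i = m i" if "i \<in> {1..2*n-1}" for i
    using that by (simp add: mdef)
  define L where "L p = (LINT x|\<mu>. poly p x)" for p
  interpret positive_functional L n
  proof
    show "L (p + q) = L p + L q" for p q
      by (simp add: L_def integrable_poly[OF mu])
    show "L (Polynomial.smult c p) = c * L p" for c p by (simp add: L_def)
    show "L 1 = 1" using mu by (simp add: L_def prob_all_moments_def prob_space.prob_space)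
    show "L (p * p) > 0" if "p \<noteq> 0" "degree p < n" for p
      unfolding L_def using that by (intro integral_square_pos[OF m mu mm]) auto
  qed
  have same: "(LINT x|\<nu>. poly p x) = L p"
    if "\<nu> \<in> prob_all_moments" "\<forall>i\<in>{1..2*n-1}. moment \<nu> i = m i" "degree p \<le> 2 * n - 1" for \<nu> p
  proof -
    have "moment \<nu> i = moment \<mu> i" if "i \<le> 2 * n - 1" for i
      using \<open>\<nu> \<in> _\<close> mu mm[of i] \<open>\<forall>i\<in>{1..2*n-1}. _ i\<close> that by (cases "i = 0") (auto simp: moment_0)
    then show ?thesis
      unfolding L_def using that mu by (simp add: integral_poly_eq_moments[where d = "2 * n - 1"])
  qed
  define b where "b k = jacobi_coeffs (2 * k - 1)" for k
  define a where "a k = jacobi_coeffs (2 * k)" for k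
  have ex: "recursion_coeffs n m b a"
    unfolding recursion_coeffs_def
  proof (intro exI[of _ P] conjI ballI)
    show "monic_orthogonal_polys n m P"
      unfolding monic_orthogonal_polys_def
    proof (intro conjI allI ballI impI)
      show "degree (P k) = k" "lead_coeff (P k) = 1" for k using monic[of k] by auto
      fix \<nu> j k
      assume nu: "\<nu> \<in> prob_all_moments" "\<forall>i\<in>{1..2*n-1}. moment \<nu> i = m i"
        and jk: "j \<le> n" "k \<le> n" "j \<noteq> k"
      have "degree (P j * P k) = j + k" using monic P_nonzero by (simp add: degree_mult_eq)
      then have "(LINT x|\<nu>. poly (P j * P k) x) = L (P j * P k)"
        using jk by (intro same[OF nu]) auto
      then show "(LINT x|\<nu>. poly (P j) x * poly (P k) x) = 0"
        using orthogonal[OF jk] by simp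
    qed
    show "P 1 = [:- b 1, 1:]" using jacobi_coeffs_odd[of 0] by (simp add: b_def)
    fix k assume "k \<in> {1..n - 1}"
    then show "X * P k = P (k + 1) + Polynomial.smult (b (k + 1)) (P k) + Polynomial.smult (a k) (P (k - 1))"
      using three_term[of k] by (simp add: a_def b_def)
  qed
  have uniq: "(\<forall>k\<in>{1..n}. b' k = b k) \<and> (\<forall>k\<in>{1..n-1}. a' k = a k)"
    if "recursion_coeffs n m b' a'" for b' a'
  proof -
    from that obtain Q where Q: "monic_orthogonal_polys n m Q" "Q 1 = [:- b' 1, 1:]"
      "\<And>k. k \<in> {1..n-1} \<Longrightarrow> X * Q k =
        Q (k + 1) + Polynomial.smult (b' (k + 1)) (Q k) + Polynomial.smult (a' k) (Q (k - 1))"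
      unfolding recursion_coeffs_def by blast
    have "degree (Q k) = k \<and> coeff (Q k) k = 1" if "k \<le> n" for k
      using Q(1) that unfolding monic_orthogonal_polys_def by metis
    moreover have "L (Q j * Q k) = 0" if "j \<le> n" "k \<le> n" "j \<noteq> k" for j k
    proof -
      have "L (Q j * Q k) = (LINT x|\<mu>. poly (Q j) x * poly (Q k) x)"
        unfolding L_def by (rule Bochner_Integration.integral_cong) simp_all
      then show ?thesis using Q(1) that mu mm unfolding monic_orthogonal_polys_def by simp
    qed
    ultimately have *: "k < n \<Longrightarrow> b' (k + 1) = jacobi_coeffs (2 * k + 1)"
      "1 \<le> k \<Longrightarrow> k < n \<Longrightarrow> a' k = jacobi_coeffs (2 * k)" for k
      using recursion_unique[of Q b' a', OF _ _ Q(2) Q(3) n] by simp_all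
    have "b' k = b k" if "k \<in> {1..n}" for k
      using *(1)[of "k - 1"] that by (cases k) (auto simp: b_def)
    moreover have "a' k = a k" if "k \<in> {1..n-1}" for k
      using *(2)[of k] that by (auto simp: a_def)
    ultimately show ?thesis by blast
  qed
  show thesis
  proof (rule that)
    show "jacobi_coeffs \<in> admissible (2 * n - 1)" by (rule jacobi_coeffs_admissible)
    have "moment \<mu> s = path_sum jacobi_coeffs s 0" if "s \<in> {1..2*n-1}" for s
    proof -
      have "L (X ^ s * P 0) = path_sum jacobi_coeffs s 0"
        using that n by (intro moment_eq_path_sum) auto
      then show ?thesis by (simp add: L_def moment_def)
    qed
    then show "m = moment_map (2 * n - 1) jacobi_coeffs"
      unfolding mdef moment_map_def by (intro restrict_ext) simp
    fix k
    show "rec_b n m k = jacobi_coeffs (2 * k - 1)" if "k \<in> {1..n}"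
      unfolding rec_b_def
    proof (rule the_equality)
      show "\<exists>b a. recursion_coeffs n m b a \<and> b k = jacobi_coeffs (2 * k - 1)"
        using ex by (intro exI[of _ b] exI[of _ a]) (simp add: b_def)
      show "\<And>x. \<exists>b a. recursion_coeffs n m b a \<and> b k = x \<Longrightarrow> x = jacobi_coeffs (2 * k - 1)"
        using uniq that by (auto simp: b_def)
    qed
    show "rec_a n m k = jacobi_coeffs (2 * k)" if "k \<in> {1..n-1}"
      unfolding rec_a_def
    proof (rule the_equality)
      show "\<exists>b a. recursion_coeffs n m b a \<and> a k = jacobi_coeffs (2 * k)"
        using ex by (intro exI[of _ b] exI[of _ a]) (simp add: a_def)
      show "\<And>x. \<exists>b a. recursion_coeffs n m b a \<and> a k = x \<Longrightarrow> x = jacobi_coeffs (2 * k)"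
        using uniq that by (auto simp: a_def)
    qed
  qed
qed

section \<open>The law of the recursion coefficients\<close>

lemma PiM_density_lborel:
  fixes f :: "'i \<Rightarrow> real \<Rightarrow> ennreal"
  assumes I: "finite I"
    and f: "\<And>i. i \<in> I \<Longrightarrow> f i \<in> borel_measurable borel"
    and prob: "\<And>i. i \<in> I \<Longrightarrow> prob_space (density lborel (f i))"
  shows "(\<Pi>\<^sub>M i\<in>I. density lborel (f i)) = density (\<Pi>\<^sub>M i\<in>I. lborel) (\<lambda>x. \<Prod>i\<in>I. f i (x i))"
proof -
  \<comment> \<open>The locale of product measures concerns families defined on the whole index type, so the family is
    continued by a \<open>\<sigma>\<close>-finite measure.\<close>
  define N where "N i = (if i \<in> I then density lborel (f i) else lborel)" for i
  have PN: "(\<Pi>\<^sub>M i\<in>I. density lborel (f i)) = PiM I N"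
    by (rule PiM_cong) (simp_all add: N_def)
  have sets_N: "sets (N i) = sets borel" for i by (simp add: N_def)
  have "sigma_finite_measure (N i)" for i
    using prob[of i] prob_space_imp_sigma_finite sigma_finite_lborel by (auto simp: N_def)
  then interpret N: product_sigma_finite N by (rule product_sigma_finite.intro)
  interpret L: product_sigma_finite "\<lambda>_::'i. lborel :: real measure" by standard
  have meas: "(\<lambda>x. \<Prod>i\<in>I. f i (x i)) \<in> borel_measurable (\<Pi>\<^sub>M i\<in>I. lborel)"
    using f by (intro borel_measurable_prod_ennreal measurable_compose[OF measurable_component_singleton]) auto
  have sets_eq: "sets (\<Pi>\<^sub>M i\<in>I. (lborel :: real measure)) = sets (PiM I N)"
    by (intro sets_PiM_cong) (simp_all add: sets_N)
  have "density (\<Pi>\<^sub>M i\<in>I. lborel) (\<lambda>x. \<Prod>i\<in>I. f i (x i)) = PiM I N"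
  proof (rule N.PiM_eqI[OF I])
    show "sets (density (\<Pi>\<^sub>M i\<in>I. lborel) (\<lambda>x. \<Prod>i\<in>I. f i (x i))) = sets (PiM I N)"
      using sets_eq by simp
    fix A assume "\<And>i. i \<in> I \<Longrightarrow> A i \<in> sets (N i)"
    then have A: "i \<in> I \<Longrightarrow> A i \<in> sets borel" for i by (simp add: sets_N)
    have box: "Pi\<^sub>E I A \<in> sets (\<Pi>\<^sub>M i\<in>I. (lborel :: real measure))"
      using A by (intro sets_PiM_I_finite I) auto
    have "emeasure (density (\<Pi>\<^sub>M i\<in>I. lborel) (\<lambda>x. \<Prod>i\<in>I. f i (x i))) (Pi\<^sub>E I A) =
        (\<integral>\<^sup>+ x. (\<Prod>i\<in>I. f i (x i)) * indicator (Pi\<^sub>E I A) x \<partial>(\<Pi>\<^sub>M i\<in>I. lborel))"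
      by (rule emeasure_density[OF meas box])
    also have "\<dots> = (\<integral>\<^sup>+ x. (\<Prod>i\<in>I. f i (x i) * indicator (A i) (x i)) \<partial>(\<Pi>\<^sub>M i\<in>I. lborel))"
    proof (rule nn_integral_cong)
      fix x assume "x \<in> space (\<Pi>\<^sub>M i\<in>I. (lborel :: real measure))"
      then have "indicator (Pi\<^sub>E I A) x = (\<Prod>i\<in>I. indicator (A i) (x i) :: ennreal)"
      proof (cases "\<forall>i\<in>I. x i \<in> A i")
        case True
        then show ?thesis using \<open>x \<in> space _\<close> by (simp add: space_PiM PiE_def Pi_def)
      next
        case False
        then obtain i where "i \<in> I" "x i \<notin> A i" by blast
        then have "(\<Prod>i\<in>I. indicator (A i) (x i) :: ennreal) = 0"
          using I by (intro prod_zero) (auto simp: indicator_def)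
        then show ?thesis using \<open>i \<in> I\<close> \<open>x i \<notin> A i\<close> by (auto simp: indicator_def)
      qed
      then show "(\<Prod>i\<in>I. f i (x i)) * indicator (Pi\<^sub>E I A) x = (\<Prod>i\<in>I. f i (x i) * indicator (A i) (x i))"
        by (simp add: prod.distrib)
    qed
    also have "\<dots> = (\<Prod>i\<in>I. \<integral>\<^sup>+ x. f i x * indicator (A i) x \<partial>lborel)"
      using f A by (intro L.product_nn_integral_prod I) (auto intro!: borel_measurable_times_ennreal)
    also have "\<dots> = (\<Prod>i\<in>I. emeasure (N i) (A i))"
      using f A by (intro prod.cong) (simp_all add: N_def emeasure_density)
    finally show "emeasure (density (\<Pi>\<^sub>M i\<in>I. lborel) (\<lambda>x. \<Prod>i\<in>I. f i (x i))) (Pi\<^sub>E I A) =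
        (\<Prod>i\<in>I. emeasure (N i) (A i))" .
  qed
  then show ?thesis using PN by simp
qed

text \<open>Shape \<open>\<alpha>\<close> and rate \<open>r\<close>.\<close>

definition gamma_density :: "real \<Rightarrow> real \<Rightarrow> real \<Rightarrow> real" where
  "gamma_density \<alpha> r x =
     (if x > 0 then r powr \<alpha> / Gamma \<alpha> * x powr (\<alpha> - 1) * exp (- r * x) else 0)"

lemma measurable_gamma_density [measurable]: "gamma_density \<alpha> r \<in> borel_measurable borel"
  unfolding gamma_density_def by measurable

lemma gamma_density_nonneg: "\<alpha> > 0 \<Longrightarrow> gamma_density \<alpha> r x \<ge> 0"
  by (auto simp: gamma_density_def intro!: mult_nonneg_nonneg divide_nonneg_pos Gamma_real_pos)

lemma nn_integral_gamma_density:
  assumes "\<alpha> > 0" "r > 0"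
  shows "(\<integral>\<^sup>+ x. ennreal (gamma_density \<alpha> r x) \<partial>lborel) = 1"
proof -
  have G: "Gamma \<alpha> > 0" using assms(1) by (rule Gamma_real_pos)
  have "(\<integral>\<^sup>+ x. ennreal (gamma_density \<alpha> r x) \<partial>lborel) =
      ennreal (1 / r) * (\<integral>\<^sup>+ t. ennreal (gamma_density \<alpha> r (0 + 1 / r * t)) \<partial>lborel)"
    using assms by (subst nn_integral_real_affine[where c = "1 / r" and t = 0]) auto
  also have "(\<integral>\<^sup>+ t. ennreal (gamma_density \<alpha> r (0 + 1 / r * t)) \<partial>lborel) =
      (\<integral>\<^sup>+ t. ennreal (r / Gamma \<alpha>) * ennreal (indicator {0..} t * t powr (\<alpha> - 1) / exp t) \<partial>lborel)"
  proof (rule nn_integral_cong)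
    fix t :: real
    show "ennreal (gamma_density \<alpha> r (0 + 1 / r * t)) =
        ennreal (r / Gamma \<alpha>) * ennreal (indicator {0..} t * t powr (\<alpha> - 1) / exp t)"
    proof (cases "t > 0")
      case True
      have "r powr \<alpha> * (t / r) powr (\<alpha> - 1) = r * t powr (\<alpha> - 1)"
        using True assms by (simp add: powr_divide powr_diff field_simps)
      then have "gamma_density \<alpha> r (0 + 1 / r * t) = r / Gamma \<alpha> * (t powr (\<alpha> - 1) / exp t)"
        using True assms G by (simp add: gamma_density_def exp_minus field_simps)
      then show ?thesis using True assms G by (simp add: ennreal_mult[symmetric])
    next
      case False
      then show ?thesis using assms
        by (cases "t = 0") (simp_all add: gamma_density_def zero_less_divide_iff)
    qed
  qed
  also have "\<dots> = ennreal (r / Gamma \<alpha>) * ennreal (Gamma \<alpha>)"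
    by (simp add: nn_integral_cmult Gamma_conv_nn_integral_real[OF assms(1)])
  also have "ennreal (1 / r) * \<dots> = ennreal (1 / r * (r / Gamma \<alpha> * Gamma \<alpha>))"
    using assms G by (simp add: ennreal_mult[symmetric])
  finally show ?thesis using assms G by simp
qed

text \<open>Variance \<open>1 / (2r)\<close>.\<close>

definition centered_normal_density :: "real \<Rightarrow> real \<Rightarrow> real" where
  "centered_normal_density r x = sqrt (r / pi) * exp (- r * x\<^sup>2)"

lemma centered_normal_density_eq:
  assumes "r > 0"
  shows "centered_normal_density r = normal_density 0 (1 / sqrt (2 * r))"
proof
  fix x
  have "(1 / sqrt (2 * r))\<^sup>2 = 1 / (2 * r)" using assms by (simp add: power_divide)
  then show "centered_normal_density r x = normal_density 0 (1 / sqrt (2 * r)) x"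
    using assms by (simp add: centered_normal_density_def normal_density_def real_sqrt_divide real_sqrt_mult)
qed

definition coeff_density :: "nat \<Rightarrow> (nat \<Rightarrow> real) \<Rightarrow> (nat \<Rightarrow> real) \<Rightarrow> nat \<Rightarrow> real \<Rightarrow> real" where
  "coeff_density n \<gamma> r s = (if odd s then centered_normal_density (r s)
     else gamma_density (\<gamma> (s div 2) + 2 * real n - 2 * real (s div 2)) (r s))"

lemma measurable_coeff_density [measurable]: "coeff_density n \<gamma> r s \<in> borel_measurable borel"
  by (auto simp: coeff_density_def centered_normal_density_def[abs_def])

lemma coeff_density_nonneg_prob:
  assumes "\<And>j. j \<ge> 1 \<Longrightarrow> \<gamma> j > -1" "r s > 0" "s \<in> {1..2*n-1}"
  shows "coeff_density n \<gamma> r s x \<ge> 0"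
    and "prob_space (density lborel (\<lambda>x. ennreal (coeff_density n \<gamma> r s x)))"
proof -
  have "coeff_density n \<gamma> r s x \<ge> 0 \<and>
    prob_space (density lborel (\<lambda>x. ennreal (coeff_density n \<gamma> r s x)))"
  proof (cases "odd s")
    case True
    then have "coeff_density n \<gamma> r s = normal_density 0 (1 / sqrt (2 * r s))"
      using assms by (simp add: coeff_density_def centered_normal_density_eq)
    then show ?thesis using assms by (simp add: prob_space_normal_density)
  next
    case False
    then obtain l where l: "s = 2 * l" by auto
    with assms have "l \<ge> 1" "l + 1 \<le> n" by auto
    then have "2 * real n - 2 * real l \<ge> 2" by linarith
    then have pos: "\<gamma> l + 2 * real n - 2 * real l > 0" using assms(1)[OF \<open>l \<ge> 1\<close>] by linarith
    then show ?thesis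
      using assms(2) l False gamma_density_nonneg[OF pos] nn_integral_gamma_density[OF pos]
      by (auto simp: coeff_density_def emeasure_density intro!: prob_spaceI)
  qed
  then show "coeff_density n \<gamma> r s x \<ge> 0"
    "prob_space (density lborel (\<lambda>x. ennreal (coeff_density n \<gamma> r s x)))" by auto
qed

lemma prod_odd_even_split:
  fixes f :: "nat \<Rightarrow> 'b :: comm_monoid_mult"
  assumes "n \<ge> 1"
  shows "(\<Prod>s=1..2*n-1. f s) = (\<Prod>k=1..n. f (2 * k - 1)) * (\<Prod>k=1..n-1. f (2 * k))"
  using assms
proof (induction n rule: dec_induct)
  case base
  then show ?case by simp
next
  case (step n)
  then obtain l where "n = Suc l" by (cases n) auto
  then show ?case using step.IH by (simp add: mult_ac)
qed

lemma jacobian_eq: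
  assumes "n \<ge> 1"
  shows "jacobian (2 * n - 1) u = (\<Prod>l=1..n-1. u (2 * l) ^ (2 * n - 1 - 2 * l))"
  using assms
proof (induction n rule: dec_induct)
  case base
  then show ?case by (simp add: jacobian_def leading_factor_def)
next
  case (step n)
  have "jacobian (2 * Suc n - 1) u =
      jacobian (2 * n - 1) u * leading_factor u (2 * n) * leading_factor u (2 * n + 1)"
  proof -
    have "jacobian (Suc (Suc N)) u = jacobian N u * leading_factor u (Suc N) * leading_factor u (Suc (Suc N))"
      for N by (simp add: jacobian_def)
    from this[of "2 * n - 1"] show ?thesis using step by simp
  qed
  also have "leading_factor u (2 * n) = (\<Prod>l=1..n-1. u (2 * l))"
  proof -
    have "(2 * n - 1) div 2 = n - 1" using step by linarith
    then show ?thesis by (simp add: leading_factor_def)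
  qed
  also have "leading_factor u (2 * n + 1) = (\<Prod>l=1..n-1. u (2 * l)) * u (2 * n)"
  proof -
    obtain q where "n = Suc q" using step by (cases n) auto
    then show ?thesis by (simp add: leading_factor_def)
  qed
  also have "jacobian (2 * n - 1) u * (\<Prod>l=1..n-1. u (2 * l)) * ((\<Prod>l=1..n-1. u (2 * l)) * u (2 * n)) =
     (\<Prod>l=1..n-1. u (2 * l) ^ (2 * n - 1 - 2 * l) * u (2 * l) * u (2 * l)) * u (2 * n)"
    using step.IH by (simp add: prod.distrib mult_ac)
  also have "(\<Prod>l=1..n-1. u (2 * l) ^ (2 * n - 1 - 2 * l) * u (2 * l) * u (2 * l)) =
     (\<Prod>l=1..n-1. u (2 * l) ^ (2 * Suc n - 1 - 2 * l))"
  proof (rule prod.cong)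
    fix l assume "l \<in> {1..n - 1}"
    then have "2 * Suc n - 1 - 2 * l = Suc (Suc (2 * n - 1 - 2 * l))" by auto
    then show "u (2 * l) ^ (2 * n - 1 - 2 * l) * u (2 * l) * u (2 * l) = u (2 * l) ^ (2 * Suc n - 1 - 2 * l)"
      by simp
  qed simp
  also have "\<dots> * u (2 * n) = (\<Prod>l=1..Suc n - 1. u (2 * l) ^ (2 * Suc n - 1 - 2 * l))"
  proof -
    obtain q where "n = Suc q" using step by (cases n) auto
    then show ?thesis by simp
  qed
  finally show ?case .
qed

text \<open>The Jacobian contributes \<open>a\<^sub>k ^ (2n - 1 - 2k)\<close>, which turns the factor \<open>a\<^sub>k powr \<gamma>\<^sub>k\<close> of the density
  into that of a gamma density of shape \<open>\<gamma>\<^sub>k + 2n - 2k\<close>.\<close>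

lemma moment_density_moment_map:
  assumes n: "n \<ge> 1" and u: "u \<in> admissible (2 * n - 1)"
    and int: "moment_map (2 * n - 1) u \<in> interior_moment_space (2 * n - 1)"
  shows "moment_density n \<gamma> r (moment_map (2 * n - 1) u) * jacobian (2 * n - 1) u =
     (\<Prod>s=1..2*n-1. coeff_density n \<gamma> r s (u s))"
proof -
  obtain v where "v \<in> admissible (2 * n - 1)"
    and v: "moment_map (2 * n - 1) u = moment_map (2 * n - 1) v"
    "\<And>k. k \<in> {1..n} \<Longrightarrow> rec_b n (moment_map (2 * n - 1) u) k = v (2 * k - 1)"
    "\<And>k. k \<in> {1..n-1} \<Longrightarrow> rec_a n (moment_map (2 * n - 1) u) k = v (2 * k)"
    by (rule interior_moment_space_recursion[OF n int], rule that)
  have uv: "u s = v s" if "1 \<le> s" "s \<le> 2 * n - 1" for s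
    using that by (intro moment_map_inj[OF v(1)] admissible_mono[OF u]) auto
  have b: "rec_b n (moment_map (2 * n - 1) u) k = u (2 * k - 1)" if "k \<in> {1..n}" for k
    using v(2)[OF that] uv[of "2 * k - 1"] that by auto
  have a: "rec_a n (moment_map (2 * n - 1) u) k = u (2 * k)" "u (2 * k) > 0" if "k \<in> {1..n-1}" for k
    using v(3)[OF that] uv[of "2 * k"] u that by (auto simp: admissible_def)
  have "(\<Prod>k=1..n. sqrt (r (2*k-1) / pi) * exp (- r (2*k-1) * (rec_b n (moment_map (2 * n - 1) u) k)\<^sup>2)) =
      (\<Prod>k=1..n. coeff_density n \<gamma> r (2 * k - 1) (u (2 * k - 1)))"
    using b by (intro prod.cong) (auto simp: coeff_density_def centered_normal_density_def)
  moreover have "(\<Prod>k=1..n-1.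
            r (2*k) powr (\<gamma> k + 2 * real n - 2 * real k) / Gamma (\<gamma> k + 2 * real n - 2 * real k)
            * rec_a n (moment_map (2 * n - 1) u) k powr \<gamma> k * exp (- r (2*k) * rec_a n (moment_map (2 * n - 1) u) k)
            * (if rec_a n (moment_map (2 * n - 1) u) k > 0 then 1 else 0)) * jacobian (2 * n - 1) u =
      (\<Prod>k=1..n-1. coeff_density n \<gamma> r (2 * k) (u (2 * k)))"
    unfolding jacobian_eq[OF n] prod.distrib[symmetric]
  proof (rule prod.cong)
    fix k assume k: "k \<in> {1..n - 1}"
    have "real (2 * n - 1 - 2 * k) = 2 * real n - 1 - 2 * real k" using k by (auto simp: of_nat_diff)
    then have "u (2 * k) powr \<gamma> k * u (2 * k) ^ (2 * n - 1 - 2 * k) =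
        u (2 * k) powr (\<gamma> k + 2 * real n - 2 * real k - 1)"
      using a(2)[OF k] by (simp add: powr_realpow[symmetric] powr_add[symmetric] algebra_simps)
    then show "r (2*k) powr (\<gamma> k + 2 * real n - 2 * real k) / Gamma (\<gamma> k + 2 * real n - 2 * real k)
            * rec_a n (moment_map (2 * n - 1) u) k powr \<gamma> k * exp (- r (2*k) * rec_a n (moment_map (2 * n - 1) u) k)
            * (if rec_a n (moment_map (2 * n - 1) u) k > 0 then 1 else 0) * u (2 * k) ^ (2 * n - 1 - 2 * k) =
        coeff_density n \<gamma> r (2 * k) (u (2 * k))"
      using a[OF k] by (simp add: coeff_density_def gamma_density_def mult_ac)
  qed simp
  ultimately show ?thesis
    using int prod_odd_even_split[OF n, of "\<lambda>s. coeff_density n \<gamma> r s (u s)"]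
    by (simp add: moment_density_def mult.assoc)
qed

text \<open>Under the given density the recursion coefficients are independent, with normal and gamma
  distributions.  Pulled back along the moment map, the density is dominated by the product density,
  with equality at the coefficient vectors whose moment vector is interior.  Both are probability
  densities: the first because \<open>X\<close> is a random variable, the second by construction.  Hence they agree
  almost everywhere.\<close>

lemma distr_moments_eq:
  assumes \<gamma>: "\<And>j. j \<ge> 1 \<Longrightarrow> \<gamma> j > -1"
    and r: "\<And>j. j \<in> {1..2*n-1} \<Longrightarrow> r j > 0"
    and n: "n \<ge> 1"
    and P: "prob_space M"
    and X: "distributed M (lebesgue_upto (2*n-1)) X (\<lambda>m. ennreal (moment_density n \<gamma> r m))"
  shows "distr M (lebesgue_upto (2*n-1)) X =
     distr (\<Pi>\<^sub>M s\<in>{1..2*n-1}. density lborel (\<lambda>x. ennreal (coeff_density n \<gamma> r s x)))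
       (lebesgue_upto (2*n-1)) (moment_map (2*n-1))"
proof -
  \<comment> \<open>This keeps the index sets in the form \<open>{1..N}\<close>.\<close>
  note One_nat_def[simp del]
  define N where "N = 2 * n - 1"
  define h where "h m = ennreal (moment_density n \<gamma> r m)" for m
  define g where "g u = (\<Prod>s\<in>{1..N}. ennreal (coeff_density n \<gamma> r s (u s)))" for u
  define k where "k u = indicator (admissible N) u * h (moment_map N u) * ennreal (jacobian N u)" for u
  note nonneg = coeff_density_nonneg_prob(1)[OF \<gamma> r]
    and prob = coeff_density_nonneg_prob(2)[OF \<gamma> r]
  interpret M: prob_space M by fact
  have distr: "distr M (lebesgue_upto N) X = density (lebesgue_upto N) h"
    using distributed_distr_eq_density[OF X] by (simp add: N_def h_def[abs_def])
  have h[measurable]: "h \<in> borel_measurable (lebesgue_upto N)"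
    using distributed_borel_measurable[OF X] by (simp add: N_def h_def[abs_def])
  have Xm: "X \<in> measurable M (lebesgue_upto N)"
    using distributed_measurable[OF X] by (simp add: N_def)
  have g_meas[measurable]: "g \<in> borel_measurable (lebesgue_upto N)"
    unfolding g_def by measurable
  have k_meas[measurable]: "k \<in> borel_measurable (lebesgue_upto N)"
    unfolding k_def by measurable
  have h0: "h m = 0" if "m \<notin> moment_map N ` admissible N" for m
  proof -
    have "m \<notin> interior_moment_space N"
    proof
      assume "m \<in> interior_moment_space N"
      then obtain u where "u \<in> admissible N" "m = moment_map N u"
        unfolding N_def by (rule interior_moment_space_recursion[OF n])
      with that show False by blast
    qed
    then show ?thesis by (simp add: h_def moment_density_def N_def)
  qed
  have cov: "(\<integral>\<^sup>+ m. h m * indicator A m \<partial>lebesgue_upto N) =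
      (\<integral>\<^sup>+ u. k u * indicator A (moment_map N u) \<partial>lebesgue_upto N)"
    if [measurable]: "A \<in> sets (lebesgue_upto N)" for A
  proof -
    have meas: "(\<lambda>m. h m * indicator A m) \<in> borel_measurable (lebesgue_upto N)" by measurable
    have "(\<integral>\<^sup>+ m. h m * indicator A m \<partial>lebesgue_upto N) =
      (\<integral>\<^sup>+ u. indicator (admissible N) u * (h (moment_map N u) * indicator A (moment_map N u)) *
        ennreal (jacobian N u) \<partial>lebesgue_upto N)"
      by (rule change_of_variables_moment_map[OF meas]) (simp add: h0)
    then show ?thesis by (simp add: k_def mult_ac)
  qed
  have int_k: "(\<integral>\<^sup>+ u. k u \<partial>lebesgue_upto N) = 1"
  proof -
    have "(\<integral>\<^sup>+ u. k u \<partial>lebesgue_upto N) =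
        (\<integral>\<^sup>+ u. k u * indicator (space (lebesgue_upto N)) (moment_map N u) \<partial>lebesgue_upto N)"
    proof (rule nn_integral_cong)
      fix u assume "u \<in> space (lebesgue_upto N)"
      from measurable_space[OF measurable_moment_map this]
      show "k u = k u * indicator (space (lebesgue_upto N)) (moment_map N u)" by simp
    qed
    also have "\<dots> = (\<integral>\<^sup>+ m. h m * indicator (space (lebesgue_upto N)) m \<partial>lebesgue_upto N)"
      by (rule cov[symmetric]) simp
    also have "\<dots> = emeasure (density (lebesgue_upto N) h) (space (lebesgue_upto N))"
      by (rule emeasure_density[OF h, symmetric]) simp
    also have "\<dots> = 1"
      using prob_space.emeasure_space_1[OF M.prob_space_distr[OF Xm]] unfolding distr by simp
    finally show ?thesis .
  qed
  have prodg: "(\<Pi>\<^sub>M s\<in>{1..N}. density lborel (\<lambda>x. ennreal (coeff_density n \<gamma> r s x))) =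
      density (lebesgue_upto N) g"
    unfolding g_def by (rule PiM_density_lborel) (auto intro!: prob simp: N_def)
  have int_g: "(\<integral>\<^sup>+ u. g u \<partial>lebesgue_upto N) = 1"
  proof -
    have "prob_space (density (lebesgue_upto N) g)"
      unfolding prodg[symmetric] by (intro prob_space_PiM prob) (auto simp: N_def)
    from prob_space.emeasure_space_1[OF this] show ?thesis by (simp add: emeasure_density[OF g_meas])
  qed
  \<comment> \<open>Outside the pullback of the interior the density of the moments is zero.\<close>
  have kg: "k u \<le> g u" for u
  proof (cases "u \<in> admissible N \<and> moment_map N u \<in> interior_moment_space N")
    case True
    then have "k u = ennreal (moment_density n \<gamma> r (moment_map N u) * jacobian N u)"
      by (simp add: k_def h_def ennreal_mult'' jacobian_nonneg)
    also have "\<dots> = ennreal (\<Prod>s=1..N. coeff_density n \<gamma> r s (u s))"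
      using moment_density_moment_map[OF n, of u \<gamma> r] True by (simp add: N_def)
    also have "\<dots> = g u"
      unfolding g_def by (rule prod_ennreal[symmetric]) (auto intro!: nonneg simp: N_def)
    finally show ?thesis by simp
  next
    case False
    then show ?thesis by (auto simp: k_def h_def moment_density_def N_def)
  qed
  \<comment> \<open>Both integrals are \<open>1\<close>, so domination becomes equality.\<close>
  have "(\<integral>\<^sup>+ u. g u - k u \<partial>lebesgue_upto N) = 0"
    using kg int_k int_g by (subst nn_integral_diff) auto
  then have "AE u in lebesgue_upto N. g u - k u = 0"
    by (subst (asm) nn_integral_0_iff_AE) auto
  then have kg_eq: "AE u in lebesgue_upto N. k u = g u"
    by eventually_elim (use kg in \<open>auto simp: diff_eq_0_iff_ennreal intro: antisym\<close>)
  have "density (lebesgue_upto N) h = distr (density (lebesgue_upto N) g) (lebesgue_upto N) (moment_map N)"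
  proof (rule measure_eqI)
    fix A assume "A \<in> sets (density (lebesgue_upto N) h)"
    then have A[measurable]: "A \<in> sets (lebesgue_upto N)" by simp
    have "emeasure (density (lebesgue_upto N) h) A = (\<integral>\<^sup>+ u. k u * indicator A (moment_map N u) \<partial>lebesgue_upto N)"
      using emeasure_density[OF h A] cov[OF A] by simp
    also have "\<dots> = (\<integral>\<^sup>+ u. g u * indicator (moment_map N -` A \<inter> space (lebesgue_upto N)) u \<partial>lebesgue_upto N)"
      using kg_eq by (intro nn_integral_cong_AE) (auto simp: indicator_def)
    also have "\<dots> = emeasure (distr (density (lebesgue_upto N) g) (lebesgue_upto N) (moment_map N)) A"
      using emeasure_density[OF g_meas measurable_sets[OF measurable_moment_map A]]
      by (subst emeasure_distr) simp_all
    finally show "emeasure (density (lebesgue_upto N) h) A =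
        emeasure (distr (density (lebesgue_upto N) g) (lebesgue_upto N) (moment_map N)) A" .
  qed simp
  then show ?thesis using distr prodg unfolding N_def by simp
qed

section \<open>Gaussian limit of the gamma densities\<close>

text \<open>The gamma density of shape \<open>\<tau> + 1\<close> and rate \<open>1\<close>, up to a constant factor, after the substitution
  \<open>x = \<tau> + sqrt \<tau> * w\<close>.  Centring at the mode \<open>\<tau>\<close> rather than at the mean makes it the \<open>\<tau>\<close>-th power of
  \<open>(1 + y) exp (- y)\<close> with \<open>y = w / sqrt \<tau>\<close>, which gives a clean Gaussian limit and a uniform bound.\<close>

definition gamma_profile :: "real \<Rightarrow> real \<Rightarrow> real" where
  "gamma_profile \<tau> w =
     (if 1 + w / sqrt \<tau> > 0 then (1 + w / sqrt \<tau>) powr \<tau> * exp (- sqrt \<tau> * w) else 0)"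

lemma measurable_gamma_profile [measurable]: "gamma_profile \<tau> \<in> borel_measurable borel"
  unfolding gamma_profile_def by measurable

lemma gamma_profile_nonneg: "gamma_profile \<tau> w \<ge> 0"
  by (simp add: gamma_profile_def)

lemma gamma_profile_tendsto: "((\<lambda>\<tau>. gamma_profile \<tau> w) \<longlongrightarrow> exp (- w\<^sup>2 / 2)) at_top"
proof -
  have "((\<lambda>\<tau>. (1 + w / sqrt \<tau>) powr \<tau> * exp (- sqrt \<tau> * w)) \<longlongrightarrow> exp (- w\<^sup>2 / 2)) at_top"
    by (cases w "0::real" rule: linorder_cases) (real_asymp simp: power2_eq_square)+
  moreover have "eventually (\<lambda>\<tau>. 1 + w / sqrt \<tau> > 0) at_top"
    by real_asymp
  ultimately show ?thesis
    by (rule Lim_transform_eventually[OF _ eventually_mono]) (simp add: gamma_profile_def)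
qed

lemma ln_1_plus_le_quadratic_neg:
  assumes "-1 < x" "x \<le> (0::real)"
  shows "ln (1 + x) \<le> x - x\<^sup>2 / 2"
proof -
  define f where "f x = x - x\<^sup>2 / 2 - ln (1 + x)" for x :: real
  have "f 0 \<le> f x"
  proof (rule DERIV_nonpos_imp_nonincreasing[of x 0 f])
    fix y assume y: "x \<le> y" "y \<le> 0"
    then have pos: "1 + y > 0" using assms by linarith
    then have "(f has_real_derivative (1 - y - 1 / (1 + y))) (at y)"
      unfolding f_def by (auto intro!: derivative_eq_intros)
    moreover have "1 - y - 1 / (1 + y) \<le> 0"
    proof -
      have "(1 - y) * (1 + y) \<le> 1" by (simp add: algebra_simps)
      then have "1 - y \<le> 1 / (1 + y)" using pos by (simp add: pos_le_divide_eq)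
      then show ?thesis by simp
    qed
    ultimately show "\<exists>z. (f has_real_derivative z) (at y) \<and> z \<le> 0" by blast
  qed (rule assms)
  then show ?thesis by (simp add: f_def)
qed

text \<open>This is \<open>y \<le> sinh y\<close> for \<open>y = ln (1 + x)\<close>.\<close>

lemma ln_1_plus_le_pos:
  assumes "0 \<le> (x::real)"
  shows "ln (1 + x) \<le> x - x\<^sup>2 / (2 * (1 + x))"
proof -
  have "ln (1 + x) \<le> (exp (ln (1 + x)) - inverse (exp (ln (1 + x)))) / 2"
    using assms by (intro real_le_x_sinh) simp
  also have "\<dots> = (1 + x - 1 / (1 + x)) / 2"
    using assms by (simp add: inverse_eq_divide)
  also have "\<dots> = x - x\<^sup>2 / (2 * (1 + x))"
  proof -
    have "1 / (1 + x) = 1 - x / (1 + x)" "x\<^sup>2 / (2 * (1 + x)) = (x - x / (1 + x)) / 2"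
      using assms by (simp_all add: divide_simps) (simp_all add: algebra_simps power2_eq_square)
    then show ?thesis by simp
  qed
  finally show ?thesis .
qed

text \<open>An integrable bound for all the densities that occur in the limit.  On the right the gamma densities
  have only exponential tails uniformly in the shape, so that a Gaussian bound would fail.\<close>

definition dominating_density :: "real \<Rightarrow> real" where
  "dominating_density w = exp ((1 - \<bar>w\<bar>) / 2)"

lemma neg_half_square_le: "- w\<^sup>2 / 2 \<le> (1 - \<bar>w\<bar>) / 2" for w :: real
proof -
  have "0 \<le> (\<bar>w\<bar> - 1)\<^sup>2 + \<bar>w\<bar>" by simp
  then show ?thesis by (simp add: power2_eq_square algebra_simps)
qed

lemma dominating_density_nonneg: "dominating_density w \<ge> 0"
  by (simp add: dominating_density_def)

text \<open>In the exponent \<open>\<tau> ln (1 + y) - \<tau> y\<close> with \<open>y = w / sqrt \<tau>\<close>, the quadratic bound of the logarithm gives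
  \<open>- w\<^sup>2 / 2\<close> for \<open>w \<le> 0\<close>; for \<open>w > 0\<close> the other bound gives \<open>- w\<^sup>2 / (2 (1 + y))\<close>, and \<open>y \<le> w\<close> since
  \<open>\<tau> \<ge> 1\<close>.\<close>

lemma gamma_profile_le:
  assumes "\<tau> \<ge> 1"
  shows "gamma_profile \<tau> w \<le> dominating_density w"
proof (cases "1 + w / sqrt \<tau> > 0")
  case False
  then show ?thesis by (simp add: gamma_profile_def dominating_density_def)
next
  case True
  define s where "s = sqrt \<tau>"
  have s: "s \<ge> 1" "s * s = \<tau>" using assms by (auto simp: s_def)
  define x where "x = w / s"
  have w: "w = s * x" using s by (simp add: x_def)
  have x: "1 + x > 0" using True by (simp add: x_def s_def)
  have "s * s * ln (1 + x) - s * w \<le> (1 - \<bar>w\<bar>) / 2"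
  proof (cases "x \<le> 0")
    case True
    have "s * s * ln (1 + x) \<le> s * s * (x - x\<^sup>2 / 2)"
      using True x by (intro mult_left_mono ln_1_plus_le_quadratic_neg) auto
    then have "s * s * ln (1 + x) - s * w \<le> - w\<^sup>2 / 2"
      by (simp add: w algebra_simps power2_eq_square)
    also have "\<dots> \<le> (1 - \<bar>w\<bar>) / 2" by (rule neg_half_square_le)
    finally show ?thesis .
  next
    case False
    have "s * s * ln (1 + x) \<le> s * s * (x - x\<^sup>2 / (2 * (1 + x)))"
      using False by (intro mult_left_mono ln_1_plus_le_pos) auto
    then have "s * s * ln (1 + x) - s * w \<le> - (w\<^sup>2 / (2 * (1 + x)))"
      by (simp add: w algebra_simps power2_eq_square)
    also have "w\<^sup>2 / (2 * (1 + x)) \<ge> w\<^sup>2 / (2 * (1 + w))"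
    proof -
      have "x \<le> w" using s False mult_right_mono[of 1 s x] by (simp add: w)
      then show ?thesis using False by (intro divide_left_mono) auto
    qed
    then have "- (w\<^sup>2 / (2 * (1 + x))) \<le> - (w\<^sup>2 / (2 * (1 + w)))" by simp
    also have "\<dots> \<le> (1 - w) / 2"
    proof -
      have "w \<ge> 0" using False s by (simp add: w)
      then show ?thesis by (simp add: field_simps power2_eq_square)
    qed
    finally show ?thesis using False s by (simp add: w)
  qed
  then have "exp (\<tau> * ln (1 + x) - s * w) \<le> exp ((1 - \<bar>w\<bar>) / 2)" using s by simp
  moreover have "gamma_profile \<tau> w = exp (\<tau> * ln (1 + x) - s * w)"
    using x by (simp add: gamma_profile_def s_def[symmetric] x_def[symmetric] powr_def exp_diff exp_minus field_simps)
  ultimately show ?thesis by (simp add: dominating_density_def)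
qed

lemma integrable_dominating_density: "integrable lborel dominating_density"
proof -
  have *: "integrable lborel (\<lambda>w::real. indicator {0..} w *\<^sub>R exp (- w / 2))"
  proof -
    have "(\<integral>\<^sup>+ x. ennreal (exponential_density (1 / 2) x) \<partial>lborel) = 1"
      using prob_space.emeasure_space_1[OF prob_space_exponential_density[of "1 / 2"]]
      by (simp add: emeasure_density)
    then have "integrable lborel (exponential_density (1 / 2))"
      by (intro integrableI_nonneg) (auto simp: exponential_density_nonneg)
    then have "integrable lborel (\<lambda>x. 2 * exponential_density (1 / 2) x)" by simp
    moreover have "(\<lambda>x. 2 * exponential_density (1 / 2) x) = (\<lambda>w. indicator {0..} w *\<^sub>R exp (- w / 2))"
      by (auto simp: exponential_density_def fun_eq_iff)
    ultimately show ?thesis by simp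
  qed
  have "integrable lborel (\<lambda>w::real. indicator {0..} (0 + (-1) * w) *\<^sub>R exp (- (0 + (-1) * w) / 2 :: real))"
    by (rule lborel_integrable_real_affine[OF *]) simp
  then have "integrable lborel (\<lambda>w::real. exp (1 / 2 :: real) * (indicator {0..} w *\<^sub>R exp (- w / 2) +
      indicator {0..} (0 + (-1) * w) *\<^sub>R exp (- (0 + (-1) * w) / 2 :: real)))"
    using * by (intro integrable_mult_right Bochner_Integration.integrable_add)
  then show ?thesis
  proof (rule Bochner_Integration.integrable_bound)
    show "dominating_density \<in> borel_measurable lborel"
      unfolding dominating_density_def[abs_def] measurable_lborel2
      by (intro borel_measurable_continuous_onI continuous_intros) simp
    show "AE w in lborel. norm (dominating_density w) \<le> norm (exp (1 / 2) * (indicator {0..} w *\<^sub>R exp (- w / 2) +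
      indicator {0..} (0 + (-1) * w) *\<^sub>R exp (- (0 + (-1) * w) / 2)))"
    proof (rule AE_I2)
      fix w :: real
      have split: "dominating_density w = exp (1 / 2) * exp (- \<bar>w\<bar> / 2)"
        unfolding dominating_density_def exp_add[symmetric] by (simp add: diff_divide_distrib)
      show "norm (dominating_density w) \<le> norm (exp (1 / 2) * (indicator {0..} w *\<^sub>R exp (- w / 2) +
        indicator {0..} (0 + (-1) * w) *\<^sub>R exp (- (0 + (-1) * w) / 2)))"
        unfolding split by (cases w "0::real" rule: linorder_cases) simp_all
    qed
  qed
qed

text \<open>The normalizing constant of \<open>gamma_profile \<tau>\<close>.\<close>

definition gamma_const :: "real \<Rightarrow> real" where
  "gamma_const \<tau> = sqrt \<tau> * \<tau> powr \<tau> * exp (- \<tau>) / Gamma (\<tau> + 1)"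

lemma gamma_const_pos: "\<tau> > 0 \<Longrightarrow> gamma_const \<tau> > 0"
  by (auto simp: gamma_const_def intro!: divide_pos_pos mult_pos_pos Gamma_real_pos)

lemma gamma_density_rescaled:
  assumes "\<tau> > 0" "r > 0"
  shows "sqrt \<tau> / r * gamma_density (\<tau> + 1) r (\<tau> / r + sqrt \<tau> / r * w) =
     gamma_const \<tau> * gamma_profile \<tau> w"
proof -
  define y where "y = 1 + w / sqrt \<tau>"
  have x: "\<tau> / r + sqrt \<tau> / r * w = \<tau> / r * y"
  proof -
    have "\<tau> / r * (w / sqrt \<tau>) = \<tau> / sqrt \<tau> / r * w" by simp
    also have "\<tau> / sqrt \<tau> = sqrt \<tau>" using assms by (intro real_div_sqrt) simp
    finally show ?thesis by (simp add: y_def distrib_left)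
  qed
  show ?thesis
  proof (cases "y > 0")
    case False
    then have "\<tau> * y \<le> 0" using assms by (simp add: mult_le_0_iff)
    then have "\<tau> / r * y \<le> 0" using assms by (simp add: divide_le_0_iff)
    then show ?thesis unfolding x using False by (simp add: gamma_density_def gamma_profile_def y_def)
  next
    case True
    have pw: "r powr (\<tau> + 1) * (\<tau> / r * y) powr \<tau> = r * (\<tau> powr \<tau> * y powr \<tau>)"
      using assms True by (simp add: powr_mult powr_divide powr_add)
    have "r * (\<tau> / r * y) = \<tau> + sqrt \<tau> * w"
      unfolding x[symmetric] using assms by (simp add: distrib_left)
    then have ex: "exp (- r * (\<tau> / r * y)) = exp (- \<tau>) * exp (- sqrt \<tau> * w)"
      by (simp add: exp_add[symmetric])
    have "sqrt \<tau> / r * gamma_density (\<tau> + 1) r (\<tau> / r * y) =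
        sqrt \<tau> / r * ((r powr (\<tau> + 1) * (\<tau> / r * y) powr \<tau>) * exp (- r * (\<tau> / r * y)) / Gamma (\<tau> + 1))"
      using assms True by (simp add: gamma_density_def)
    also have "\<dots> = gamma_const \<tau> * (y powr \<tau> * exp (- sqrt \<tau> * w))"
      unfolding pw ex gamma_const_def using assms by simp
    finally show ?thesis unfolding x using True by (simp add: gamma_profile_def y_def)
  qed
qed

lemma integrable_gamma_profile:
  assumes "\<tau> \<ge> 1"
  shows "integrable lborel (gamma_profile \<tau>)"
proof (rule Bochner_Integration.integrable_bound[OF integrable_dominating_density])
  show "AE w in lborel. norm (gamma_profile \<tau> w) \<le> norm (dominating_density w)"
  proof (rule AE_I2)
    fix w
    show "norm (gamma_profile \<tau> w) \<le> norm (dominating_density w)"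
      using gamma_profile_le[OF assms, of w] gamma_profile_nonneg[of \<tau> w] by simp
  qed
qed simp

lemma integral_gamma_profile:
  assumes "\<tau> \<ge> 1"
  shows "gamma_const \<tau> * (LINT w|lborel. gamma_profile \<tau> w) = 1"
proof -
  have pos: "gamma_const \<tau> > 0" "sqrt \<tau> > 0" using assms by (auto intro!: gamma_const_pos)
  have "1 = (\<integral>\<^sup>+ x. ennreal (gamma_density (\<tau> + 1) 1 x) \<partial>lborel)"
    using assms by (intro nn_integral_gamma_density[symmetric]) auto
  also have "\<dots> = ennreal (sqrt \<tau>) * (\<integral>\<^sup>+ w. ennreal (gamma_density (\<tau> + 1) 1 (\<tau> + sqrt \<tau> * w)) \<partial>lborel)"
    using pos by (subst nn_integral_real_affine[where c = "sqrt \<tau>" and t = \<tau>]) auto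
  also have "\<dots> = (\<integral>\<^sup>+ w. ennreal (sqrt \<tau> * gamma_density (\<tau> + 1) 1 (\<tau> + sqrt \<tau> * w)) \<partial>lborel)"
    using pos assms
    by (subst nn_integral_cmult[symmetric]) (auto simp: ennreal_mult gamma_density_nonneg)
  also have "\<dots> = (\<integral>\<^sup>+ w. ennreal (gamma_const \<tau> * gamma_profile \<tau> w) \<partial>lborel)"
    using gamma_density_rescaled[of \<tau> 1] assms by simp
  also have "\<dots> = ennreal (LINT w|lborel. gamma_const \<tau> * gamma_profile \<tau> w)"
    using pos by (intro nn_integral_eq_integral integrable_mult_right integrable_gamma_profile assms)
      (auto simp: gamma_profile_nonneg)
  finally show ?thesis by (simp add: ennreal_eq_1)
qed

text \<open>This is Stirling's formula for the Gamma function.  It comes from the normalization: the constant is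
  the reciprocal of \<open>\<integral> gamma_profile \<tau>\<close>, which tends to \<open>\<integral> exp (- w\<^sup>2 / 2)\<close> by dominated convergence.\<close>

lemma gamma_const_tendsto: "(gamma_const \<longlongrightarrow> 1 / sqrt (2 * pi)) at_top"
proof -
  have "((\<lambda>\<tau>. LINT w|lborel. gamma_profile \<tau> w) \<longlongrightarrow> (LINT w|lborel. exp (- w\<^sup>2 / 2))) at_top"
  proof (rule integral_dominated_convergence_at_top)
    show "integrable lborel dominating_density" by (rule integrable_dominating_density)
    show "\<forall>\<^sub>F \<tau> in at_top. AE w in lborel. norm (gamma_profile \<tau> w) \<le> dominating_density w"
      using eventually_ge_at_top[of 1]
      by eventually_elim (auto simp: gamma_profile_nonneg gamma_profile_le)
    show "AE w in lborel. ((\<lambda>\<tau>. gamma_profile \<tau> w) \<longlongrightarrow> exp (- w\<^sup>2 / 2)) at_top"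
      by (intro AE_I2 gamma_profile_tendsto)
  qed simp_all
  also have "(LINT w|lborel. exp (- w\<^sup>2 / 2)) = sqrt (2 * pi)"
  proof -
    have "(LINT w|lborel. exp (- w\<^sup>2 / 2)) = (LINT w|lborel. sqrt (2 * pi) * std_normal_density w)"
      by (simp add: std_normal_density_def)
    then show ?thesis by (simp add: integral_normal_density[of 1 0])
  qed
  finally have "((\<lambda>\<tau>. 1 / (LINT w|lborel. gamma_profile \<tau> w)) \<longlongrightarrow> 1 / sqrt (2 * pi)) at_top"
    by (intro tendsto_intros) auto
  moreover have "eventually (\<lambda>\<tau>. 1 / (LINT w|lborel. gamma_profile \<tau> w) = gamma_const \<tau>) at_top"
    using eventually_ge_at_top[of 1]
  proof eventually_elim
    case (elim \<tau>)
    from integral_gamma_profile[OF this] show ?case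
      by (metis divide_eq_eq mult_zero_right zero_neq_one)
  qed
  ultimately show ?thesis by (rule Lim_transform_eventually)
qed

section \<open>Affine images and densities of product measures\<close>

lemma density_lborel_affine:
  fixes p :: "real \<Rightarrow> real"
  assumes [measurable]: "p \<in> borel_measurable borel" and t: "t > 0"
  shows "density lborel (\<lambda>x. ennreal (p x)) =
     distr (density lborel (\<lambda>w. ennreal (t * p (c + t * w)))) borel (\<lambda>w. c + t * w)"
proof (rule measure_eqI)
  fix A assume "A \<in> sets (density lborel (\<lambda>x. ennreal (p x)))"
  then have [measurable]: "A \<in> sets borel" by simp
  have "emeasure (density lborel (\<lambda>x. ennreal (p x))) A =
      (\<integral>\<^sup>+ x. ennreal (p x) * indicator A x \<partial>lborel)"
    by (simp add: emeasure_density)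
  also have "\<dots> = ennreal t * (\<integral>\<^sup>+ w. ennreal (p (c + t * w)) * indicator A (c + t * w) \<partial>lborel)"
    using t by (subst nn_integral_real_affine[where c = t and t = c]) auto
  also have "\<dots> = (\<integral>\<^sup>+ w. ennreal (t * p (c + t * w)) * indicator ((\<lambda>w. c + t * w) -` A) w \<partial>lborel)"
    using t by (subst nn_integral_cmult[symmetric])
      (auto simp: ennreal_mult' indicator_def mult_ac intro!: nn_integral_cong)
  also have "\<dots> = emeasure (distr (density lborel (\<lambda>w. ennreal (t * p (c + t * w)))) borel (\<lambda>w. c + t * w)) A"
  proof -
    have "(\<lambda>w. c + t * w) -` A \<in> sets borel"
      using measurable_sets[of "\<lambda>w. c + t * w" borel borel A] by simp
    then show ?thesis by (subst emeasure_distr) (auto simp: emeasure_density)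
  qed
  finally show "emeasure (density lborel (\<lambda>x. ennreal (p x))) A =
    emeasure (distr (density lborel (\<lambda>w. ennreal (t * p (c + t * w)))) borel (\<lambda>w. c + t * w)) A" .
qed simp

lemma PiM_distr_componentwise:
  assumes I: "finite I"
    and prob: "\<And>i. i \<in> I \<Longrightarrow> prob_space (M i)"
    and f: "\<And>i. i \<in> I \<Longrightarrow> f i \<in> measurable (M i) (N i)"
  shows "(\<Pi>\<^sub>M i\<in>I. distr (M i) (N i) (f i)) = distr (PiM I M) (PiM I N) (\<lambda>x. \<lambda>i\<in>I. f i (x i))"
proof -
  \<comment> \<open>Outside \<open>I\<close> the families are continued by a \<open>\<sigma>\<close>-finite measure.\<close>
  define M' where "M' i = (if i \<in> I then M i else count_space {undefined})" for i
  define D where "D i = (if i \<in> I then distr (M i) (N i) (f i) else count_space {undefined})" for i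
  have "sigma_finite_measure (D i)" for i
    using prob_space_imp_sigma_finite[OF prob_space.prob_space_distr[OF prob f]]
    by (auto simp: D_def intro: sigma_finite_measure_count_space_finite)
  then interpret D: product_sigma_finite D by (rule product_sigma_finite.intro)
  have "sigma_finite_measure (M' i)" for i
    using prob_space_imp_sigma_finite[OF prob]
    by (auto simp: M'_def intro: sigma_finite_measure_count_space_finite)
  then interpret M': product_sigma_finite M' by (rule product_sigma_finite.intro)
  have PM: "PiM I M = PiM I M'" by (rule PiM_cong) (simp_all add: M'_def)
  have meas: "(\<lambda>x. \<lambda>i\<in>I. f i (x i)) \<in> measurable (PiM I M) (PiM I N)"
    using f by (intro measurable_restrict measurable_compose[OF measurable_component_singleton])
  have "distr (PiM I M) (PiM I N) (\<lambda>x. \<lambda>i\<in>I. f i (x i)) = PiM I D"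
  proof (rule D.PiM_eqI[OF I])
    show "sets (distr (PiM I M) (PiM I N) (\<lambda>x. \<lambda>i\<in>I. f i (x i))) = sets (PiM I D)"
      by (simp, rule sets_PiM_cong) (simp_all add: D_def)
    fix A assume "\<And>i. i \<in> I \<Longrightarrow> A i \<in> sets (D i)"
    then have A: "i \<in> I \<Longrightarrow> A i \<in> sets (N i)" for i by (simp add: D_def)
    define B where "B i = f i -` A i \<inter> space (M i)" for i
    have B: "i \<in> I \<Longrightarrow> B i \<in> sets (M i)" for i
      using measurable_sets[OF f A] by (simp add: B_def)
    have "emeasure (distr (PiM I M) (PiM I N) (\<lambda>x. \<lambda>i\<in>I. f i (x i))) (Pi\<^sub>E I A) =
        emeasure (PiM I M) ((\<lambda>x. \<lambda>i\<in>I. f i (x i)) -` Pi\<^sub>E I A \<inter> space (PiM I M))"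
      using A by (intro emeasure_distr[OF meas] sets_PiM_I_finite I)
    also have "(\<lambda>x. \<lambda>i\<in>I. f i (x i)) -` Pi\<^sub>E I A \<inter> space (PiM I M) = Pi\<^sub>E I B"
      by (auto simp: space_PiM B_def PiE_iff)
    also have "emeasure (PiM I M) (Pi\<^sub>E I B) = (\<Prod>i\<in>I. emeasure (M' i) (B i))"
      unfolding PM using B by (intro M'.emeasure_PiM I) (simp add: M'_def)
    also have "\<dots> = (\<Prod>i\<in>I. emeasure (D i) (A i))"
      using f A by (intro prod.cong) (simp_all add: D_def M'_def B_def emeasure_distr)
    finally show "emeasure (distr (PiM I M) (PiM I N) (\<lambda>x. \<lambda>i\<in>I. f i (x i))) (Pi\<^sub>E I A) =
      (\<Prod>i\<in>I. emeasure (D i) (A i))" .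
  qed
  moreover have "(\<Pi>\<^sub>M i\<in>I. distr (M i) (N i) (f i)) = PiM I D"
    by (rule PiM_cong) (simp_all add: D_def)
  ultimately show ?thesis by simp
qed

lemma integral_PiM_density:
  fixes f :: "(nat \<Rightarrow> real) \<Rightarrow> real"
  assumes I: "finite I" and q: "\<And>i. i \<in> I \<Longrightarrow> q i \<in> borel_measurable borel"
    and nn: "\<And>i x. i \<in> I \<Longrightarrow> q i x \<ge> 0"
    and prob: "\<And>i. i \<in> I \<Longrightarrow> prob_space (density lborel (\<lambda>x. ennreal (q i x)))"
    and f: "f \<in> borel_measurable (\<Pi>\<^sub>M i\<in>I. borel)"
  shows "(LINT w|(\<Pi>\<^sub>M i\<in>I. density lborel (\<lambda>x. ennreal (q i x))). f w) =
     (LINT w|(\<Pi>\<^sub>M i\<in>I. lborel). (\<Prod>i\<in>I. q i (w i)) * f w)"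
proof -
  have sets: "sets (\<Pi>\<^sub>M i\<in>I. (lborel :: real measure)) = sets (\<Pi>\<^sub>M i\<in>I. borel)"
    by (intro sets_PiM_cong) auto
  have f': "f \<in> borel_measurable (\<Pi>\<^sub>M i\<in>I. lborel)"
    using f by (subst measurable_cong_sets[OF sets refl])
  have "(\<Pi>\<^sub>M i\<in>I. density lborel (\<lambda>x. ennreal (q i x))) =
      density (\<Pi>\<^sub>M i\<in>I. lborel) (\<lambda>w. \<Prod>i\<in>I. ennreal (q i (w i)))"
    by (rule PiM_density_lborel[OF I]) (use q prob in auto)
  also have "(\<lambda>w. \<Prod>i\<in>I. ennreal (q i (w i))) = (\<lambda>w. ennreal (\<Prod>i\<in>I. q i (w i)))"
    using nn by (intro ext prod_ennreal)
  finally have eq: "(\<Pi>\<^sub>M i\<in>I. density lborel (\<lambda>x. ennreal (q i x))) =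
      density (\<Pi>\<^sub>M i\<in>I. lborel) (\<lambda>w. ennreal (\<Prod>i\<in>I. q i (w i)))" .
  have meas: "(\<lambda>w. \<Prod>i\<in>I. q i (w i)) \<in> borel_measurable (\<Pi>\<^sub>M i\<in>I. lborel)"
    using q by (intro borel_measurable_prod measurable_compose[OF measurable_component_singleton]) auto
  show ?thesis
    unfolding eq using nn by (intro integral_real_density f' meas AE_I2 prod_nonneg) auto
qed

section \<open>The normalized moment vector\<close>

lemma D_mat_carrier: "D_mat k \<in> carrier_mat k k"
  by (simp add: D_mat_def)

text \<open>The matrix \<open>D\<close> is lower unitriangular, so its determinant is \<open>1\<close>.\<close>

lemma D_mat_inverse:
  obtains B where "mat_inverse (D_mat k) = Some B" "B \<in> carrier_mat k k"
    "\<And>i l. i < k \<Longrightarrow> l < k \<Longrightarrow> (\<Sum>j<k. B $$ (i, j) * D_entry (j + 1) (l + 1)) = (if i = l then 1 else 0)"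
proof -
  have "Determinant.det (D_mat k) = prod_list (diag_mat (D_mat k))"
    by (rule det_lower_triangular[OF _ D_mat_carrier]) (simp add: D_mat_def D_entry_eq_0)
  also have "diag_mat (D_mat k) = map (\<lambda>_. 1) [0..<k]"
    by (auto simp: diag_mat_def D_mat_def D_entry_refl)
  also have "prod_list (map (\<lambda>_. 1) [0..<k]) = (1::real)"
    by (induction k) auto
  finally have "D_mat k \<in> Units (ring_mat TYPE(real) k ())"
    by (intro det_non_zero_imp_unit[OF D_mat_carrier]) simp
  then have "mat_inverse (D_mat k) \<noteq> None"
    using mat_inverse(1)[OF D_mat_carrier, of k "()"] by auto
  then obtain B where B: "mat_inverse (D_mat k) = Some B" by blast
  from mat_inverse(2)[OF D_mat_carrier this] have inv: "B * D_mat k = 1\<^sub>m k" "B \<in> carrier_mat k k" by auto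
  have "(\<Sum>j<k. B $$ (i, j) * D_entry (j + 1) (l + 1)) = (if i = l then 1 else 0)" if "i < k" "l < k" for i l
  proof -
    have "(B * D_mat k) $$ (i, l) = (\<Sum>j<k. B $$ (i, j) * D_entry (j + 1) (l + 1))"
      using that inv(2) by (simp add: D_mat_def scalar_prod_def lessThan_atLeast0)
    then show ?thesis using inv(1) that by simp
  qed
  with B inv(2) show ?thesis by (rule that)
qed

lemma normalized_moments_eq:
  assumes "mat_inverse (D_mat k) = Some B" "B \<in> carrier_mat k k"
  shows "normalized_moments n k m = (\<lambda>i\<in>{..<k}. \<Sum>j<k. B $$ (i, j) *
     (sqrt (2 * real n) * (m (j + 1) - D_entry (j + 1) 0)))"
  unfolding normalized_moments_def
proof (rule restrict_ext)
  fix i assume "i \<in> {..<k}"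
  then show "vec_index (sqrt (2 * real n) \<cdot>\<^sub>v (the (mat_inverse (D_mat k)) *\<^sub>v
      Matrix.vec k (\<lambda>i. m (i + 1) - moment semicircle (i + 1)))) i =
    (\<Sum>j<k. B $$ (i, j) * (sqrt (2 * real n) * (m (j + 1) - D_entry (j + 1) 0)))"
    using assms by (simp add: scalar_prod_def lessThan_atLeast0 sum_distrib_left mult_ac moment_semicircle)
qed

section \<open>Standardized recursion coefficients\<close>

text \<open>The shape parameter of \<open>a\<^sub>l\<close>, minus one: the parameter \<open>\<tau>\<close> of \<open>gamma_profile\<close>.\<close>

definition gamma_shape_pred :: "(nat \<Rightarrow> real) \<Rightarrow> nat \<Rightarrow> nat \<Rightarrow> real" where
  "gamma_shape_pred \<gamma> n l = \<gamma> l + 2 * real n - 2 * real l - 1"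

text \<open>The recursion coefficient of index \<open>s\<close> has the law of \<open>coeff_center + coeff_scale * W\<close>, where \<open>W\<close> has
  density \<open>standardized_density\<close>.  For an even index this is the mode of the gamma distribution of rate
  \<open>2n\<close> and its natural scale.\<close>

definition coeff_center :: "(nat \<Rightarrow> real) \<Rightarrow> nat \<Rightarrow> nat \<Rightarrow> real" where
  "coeff_center \<gamma> n s = (if odd s then 0 else gamma_shape_pred \<gamma> n (s div 2) / (2 * real n))"

definition coeff_scale :: "(nat \<Rightarrow> real) \<Rightarrow> nat \<Rightarrow> nat \<Rightarrow> real" where
  "coeff_scale \<gamma> n s = (if odd s then 1 / sqrt (2 * real n)
     else sqrt (gamma_shape_pred \<gamma> n (s div 2)) / (2 * real n))"

definition standardized_density :: "(nat \<Rightarrow> real) \<Rightarrow> nat \<Rightarrow> nat \<Rightarrow> real \<Rightarrow> real" where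
  "standardized_density \<gamma> n s w = (if odd s then std_normal_density w
     else gamma_const (gamma_shape_pred \<gamma> n (s div 2)) * gamma_profile (gamma_shape_pred \<gamma> n (s div 2)) w)"

lemma measurable_standardized_density [measurable]:
  "standardized_density \<gamma> n s \<in> borel_measurable borel"
  by (cases "odd s") (simp_all add: standardized_density_def[abs_def])

lemma gamma_shape_pred_at_top: "filterlim (\<lambda>n. gamma_shape_pred \<gamma> n l) at_top sequentially"
  unfolding gamma_shape_pred_def by real_asymp

lemma coeff_density_rescaled:
  assumes n: "n \<ge> 1" and \<tau>: "even s \<Longrightarrow> gamma_shape_pred \<gamma> n (s div 2) > 0"
    and r: "odd s \<Longrightarrow> r s = real n" "even s \<Longrightarrow> r s = 2 * real n"
  shows "coeff_scale \<gamma> n s * coeff_density n \<gamma> r s (coeff_center \<gamma> n s + coeff_scale \<gamma> n s * w) =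
     standardized_density \<gamma> n s w"
proof (cases "odd s")
  case True
  have "real n * (1 / sqrt (2 * real n) * w)\<^sup>2 = w\<^sup>2 / 2"
    using n by (simp add: power_mult_distrib power_divide)
  moreover have "1 / sqrt (2 * real n) * sqrt (real n / pi) = 1 / sqrt (2 * pi)"
    using n by (simp add: real_sqrt_divide real_sqrt_mult)
  moreover have "coeff_scale \<gamma> n s * coeff_density n \<gamma> r s (coeff_center \<gamma> n s + coeff_scale \<gamma> n s * w) =
      1 / sqrt (2 * real n) * sqrt (real n / pi) * exp (- (real n * (1 / sqrt (2 * real n) * w)\<^sup>2))"
    using True r(1) by (simp add: coeff_scale_def coeff_density_def coeff_center_def
        centered_normal_density_def)
  ultimately have "coeff_scale \<gamma> n s * coeff_density n \<gamma> r s (coeff_center \<gamma> n s + coeff_scale \<gamma> n s * w) =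
      1 / sqrt (2 * pi) * exp (- (w\<^sup>2 / 2))" by (simp only:)
  then show ?thesis using True by (simp add: standardized_density_def std_normal_density_def)
next
  case False
  define \<tau> where "\<tau> = gamma_shape_pred \<gamma> n (s div 2)"
  have shape: "\<gamma> (s div 2) + 2 * real n - 2 * real (s div 2) = \<tau> + 1"
    by (simp add: \<tau>_def gamma_shape_pred_def)
  show ?thesis
    using False assms gamma_density_rescaled[of \<tau> "2 * real n" w]
    by (simp add: coeff_scale_def coeff_density_def coeff_center_def standardized_density_def shape
        \<tau>_def[symmetric])
qed

lemma standardized_density_tendsto:
  "(\<lambda>n. standardized_density \<gamma> n s w) \<longlonglongrightarrow> std_normal_density w"
proof (cases "odd s")
  case True
  then show ?thesis by (simp add: standardized_density_def)
next
  case False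
  have "((\<lambda>\<tau>. gamma_const \<tau> * gamma_profile \<tau> w) \<longlongrightarrow> 1 / sqrt (2 * pi) * exp (- w\<^sup>2 / 2)) at_top"
    by (intro tendsto_mult gamma_const_tendsto gamma_profile_tendsto)
  from filterlim_compose[OF this gamma_shape_pred_at_top]
  show ?thesis using False by (simp add: standardized_density_def std_normal_density_def)
qed

lemma standardized_density_nonneg:
  "(even s \<Longrightarrow> gamma_shape_pred \<gamma> n (s div 2) > 0) \<Longrightarrow> standardized_density \<gamma> n s w \<ge> 0"
  by (auto simp: standardized_density_def gamma_profile_nonneg less_imp_le[OF gamma_const_pos])

lemma standardized_density_le:
  "eventually (\<lambda>n. \<forall>w. standardized_density \<gamma> n s w \<le> dominating_density w) sequentially"
proof (cases "odd s")
  case True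
  have "std_normal_density w \<le> dominating_density w" for w
  proof -
    have "exp (- w\<^sup>2 / 2) \<le> dominating_density w"
      using neg_half_square_le[of w] by (simp add: dominating_density_def)
    moreover have "1 / sqrt (2 * pi) * exp (- w\<^sup>2 / 2) \<le> 1 * exp (- w\<^sup>2 / 2)"
      using pi_gt3 by (intro mult_right_mono) (auto simp: divide_le_eq)
    ultimately show ?thesis by (simp add: std_normal_density_def)
  qed
  then show ?thesis using True by (simp add: standardized_density_def)
next
  case False
  have "1 / sqrt (2 * pi) < 1" using pi_gt3 by simp
  with gamma_const_tendsto have "eventually (\<lambda>\<tau>. gamma_const \<tau> < 1) at_top"
    by (rule order_tendstoD)
  with eventually_ge_at_top[of 1]
  have "eventually (\<lambda>\<tau>. \<forall>w. gamma_const \<tau> * gamma_profile \<tau> w \<le> dominating_density w) at_top"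
  proof eventually_elim
    case (elim \<tau>)
    show ?case
    proof
      fix w
      have "gamma_const \<tau> * gamma_profile \<tau> w \<le> 1 * gamma_profile \<tau> w"
        using elim by (intro mult_right_mono) (auto simp: gamma_profile_nonneg)
      then show "gamma_const \<tau> * gamma_profile \<tau> w \<le> dominating_density w"
        using gamma_profile_le[OF elim(1), of w] by simp
    qed
  qed
  from eventually_compose_filterlim[OF this gamma_shape_pred_at_top[of \<gamma> "s div 2"]]
  show ?thesis using False by (simp add: standardized_density_def)
qed

text \<open>Shape and rate of the gamma distribution are both \<open>2n\<close> up to a bounded error.  So the centre is
  \<open>1 + O(1/n)\<close> and the scale is asymptotic to \<open>1 / sqrt (2n)\<close>, the same as for the normal
  coefficients.\<close>

lemma coeff_fluctuation_tendsto:
  assumes "s \<ge> 1"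
  shows "(\<lambda>n. sqrt (2 * real n) * (coeff_center \<gamma> n s + coeff_scale \<gamma> n s * w - semicircle_coeffs s)) \<longlonglongrightarrow> w"
proof (cases "odd s")
  case True
  have "eventually (\<lambda>n. w = sqrt (2 * real n) * (coeff_center \<gamma> n s + coeff_scale \<gamma> n s * w - semicircle_coeffs s)) sequentially"
    using eventually_gt_at_top[of 0]
    by eventually_elim (use True in \<open>simp add: coeff_center_def coeff_scale_def semicircle_coeffs_def\<close>)
  then show ?thesis by (rule Lim_transform_eventually[OF tendsto_const])
next
  case False
  define \<kappa> where "\<kappa> = \<gamma> (s div 2) - 2 * real (s div 2) - 1"
  have \<tau>: "gamma_shape_pred \<gamma> n (s div 2) = \<kappa> + 2 * real n" for n
    by (simp add: gamma_shape_pred_def \<kappa>_def)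
  have 1: "(\<lambda>n. sqrt (2 * real n) * ((\<kappa> + 2 * real n) / (2 * real n) - 1)) \<longlonglongrightarrow> 0"
    by real_asymp
  have 2: "(\<lambda>n. sqrt (2 * real n) * (sqrt (\<kappa> + 2 * real n) / (2 * real n))) \<longlonglongrightarrow> 1"
  proof -
    have "(\<lambda>n. (\<kappa> + 2 * real n) / (2 * real n)) \<longlonglongrightarrow> 1" by real_asymp
    from tendsto_real_sqrt[OF this]
    have "(\<lambda>n. sqrt ((\<kappa> + 2 * real n) / (2 * real n))) \<longlonglongrightarrow> 1" by simp
    moreover have "sqrt ((\<kappa> + 2 * real n) / (2 * real n)) =
        sqrt (2 * real n) * (sqrt (\<kappa> + 2 * real n) / (2 * real n))" for n
    proof -
      have "sqrt (2 * real n) * (sqrt (\<kappa> + 2 * real n) / (2 * real n)) =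
          sqrt (\<kappa> + 2 * real n) * (sqrt (2 * real n) / (2 * real n))" by simp
      also have "sqrt (2 * real n) / (2 * real n) = inverse (sqrt (2 * real n))"
        by (rule sqrt_divide_self_eq) simp
      finally show ?thesis by (metis real_sqrt_divide divide_inverse)
    qed
    ultimately show ?thesis by simp
  qed
  have "(\<lambda>n. sqrt (2 * real n) * ((\<kappa> + 2 * real n) / (2 * real n) - 1) +
      sqrt (2 * real n) * (sqrt (\<kappa> + 2 * real n) / (2 * real n)) * w) \<longlonglongrightarrow> 0 + 1 * w"
    by (intro tendsto_intros 1 2)
  then show ?thesis
    using False by (simp add: coeff_center_def coeff_scale_def semicircle_coeffs_def \<tau> algebra_simps)
qed

definition rescaled_coeffs :: "(nat \<Rightarrow> real) \<Rightarrow> nat \<Rightarrow> (nat \<Rightarrow> real) \<Rightarrow> nat \<Rightarrow> real" where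
  "rescaled_coeffs \<gamma> n w s = coeff_center \<gamma> n s + coeff_scale \<gamma> n s * w (s - 1)"

text \<open>For fixed standardized coefficients \<open>w\<close> the fluctuations of the moments tend to \<open>D w\<close>, and \<open>D\<^sup>-\<^sup>1\<close>
  takes them back to \<open>w\<close>.  The vector \<open>w\<close> is indexed from \<open>0\<close> and the coefficients from \<open>1\<close>, whence the
  shift in \<open>rescaled_coeffs\<close>.\<close>

lemma normalized_moments_tendsto:
  assumes w: "w \<in> {..<k} \<rightarrow>\<^sub>E UNIV"
  shows "limitin (product_topology (\<lambda>_. euclideanreal) {..<k})
     (\<lambda>n. normalized_moments n k (\<lambda>s. path_sum (rescaled_coeffs \<gamma> n w) s 0)) w sequentially"
proof -
  obtain B where B: "mat_inverse (D_mat k) = Some B" "B \<in> carrier_mat k k"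
    and inv: "\<And>i l. i < k \<Longrightarrow> l < k \<Longrightarrow>
      (\<Sum>j<k. B $$ (i, j) * D_entry (j + 1) (l + 1)) = (if i = l then 1 else 0)"
    by (rule D_mat_inverse, rule that)
  have c: "filterlim (\<lambda>n. sqrt (2 * real n)) at_top sequentially" by real_asymp
  have m: "(\<lambda>n. sqrt (2 * real n) * (path_sum (rescaled_coeffs \<gamma> n w) j 0 - D_entry j 0)) \<longlonglongrightarrow>
      (\<Sum>s=1..j. D_entry j s * w (s - 1))" for j
    by (rule moments_linearize[OF c]) (simp add: rescaled_coeffs_def coeff_fluctuation_tendsto)
  have lim: "(\<lambda>n. \<Sum>j<k. B $$ (i, j) * (sqrt (2 * real n) *
      (path_sum (rescaled_coeffs \<gamma> n w) (j + 1) 0 - D_entry (j + 1) 0))) \<longlonglongrightarrow> w i" if i: "i < k" for i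
  proof -
    have "(\<lambda>n. \<Sum>j<k. B $$ (i, j) * (sqrt (2 * real n) *
        (path_sum (rescaled_coeffs \<gamma> n w) (j + 1) 0 - D_entry (j + 1) 0))) \<longlonglongrightarrow>
        (\<Sum>j<k. B $$ (i, j) * (\<Sum>s=1..j+1. D_entry (j + 1) s * w (s - 1)))"
      by (intro tendsto_intros m)
    also have "(\<Sum>j<k. B $$ (i, j) * (\<Sum>s=1..j+1. D_entry (j + 1) s * w (s - 1))) =
        (\<Sum>j<k. B $$ (i, j) * (\<Sum>l<k. D_entry (j + 1) (l + 1) * w l))"
    proof (rule sum.cong)
      fix j assume "j \<in> {..<k}"
      have "(\<Sum>s=1..j+1. D_entry (j + 1) s * w (s - 1)) = (\<Sum>l<j+1. D_entry (j + 1) (l + 1) * w l)"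
        by (rule sum.reindex_bij_witness[of _ "\<lambda>l. l + 1" "\<lambda>s. s - 1"]) auto
      also have "\<dots> = (\<Sum>l<k. D_entry (j + 1) (l + 1) * w l)"
        using \<open>j \<in> _\<close> by (intro sum.mono_neutral_left) (auto simp: D_entry_eq_0)
      finally show "B $$ (i, j) * (\<Sum>s=1..j+1. D_entry (j + 1) s * w (s - 1)) =
          B $$ (i, j) * (\<Sum>l<k. D_entry (j + 1) (l + 1) * w l)" by simp
    qed simp
    also have "\<dots> = (\<Sum>l<k. (\<Sum>j<k. B $$ (i, j) * D_entry (j + 1) (l + 1)) * w l)"
      unfolding sum_distrib_left sum_distrib_right
      by (subst sum.swap) (simp add: mult.assoc)
    also have "\<dots> = (\<Sum>l<k. if i = l then w l else 0)"
      using inv[OF i] by (intro sum.cong refl) auto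
    also have "\<dots> = w i" using i by simp
    finally show ?thesis .
  qed
  show ?thesis
    unfolding limitin_componentwise normalized_moments_eq[OF B]
    using w lim by (auto simp: PiE_def)
qed

lemma integrable_prod_dominating_density:
  "integrable (\<Pi>\<^sub>M i\<in>{..<k::nat}. lborel) (\<lambda>w. \<Prod>i<k. dominating_density (w i))"
proof -
  interpret product_sigma_finite "\<lambda>_::nat. lborel :: real measure" by standard
  show ?thesis by (rule product_integrable_prod) (auto simp: integrable_dominating_density)
qed

section \<open>Convergence in distribution\<close>

text \<open>Extending a point by zero turns a function on \<open>\<real>\<^sup>I\<close> into a function on the type of all sequences, where
  the product \<open>\<sigma>\<close>-algebra is the Borel \<open>\<sigma>\<close>-algebra.\<close>

lemma continuous_map_product_borel_measurable:
  fixes f :: "(nat \<Rightarrow> real) \<Rightarrow> real"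
  assumes "continuous_map (product_topology (\<lambda>_. euclideanreal) I) euclideanreal f"
  shows "f \<in> borel_measurable (\<Pi>\<^sub>M i\<in>I. borel)"
proof -
  define g where "g x = f (restrict x I)" for x
  have "continuous_map (product_topology (\<lambda>_::nat. euclideanreal) UNIV) (product_topology (\<lambda>_. euclideanreal) I)
      (\<lambda>x. restrict x I)"
    unfolding continuous_map_componentwise
    by (auto intro!: continuous_map_product_projection)
  from continuous_map_compose[OF this assms]
  have "continuous_map euclidean euclideanreal g"
    by (simp add: g_def[abs_def] comp_def euclidean_product_topology)
  then have "continuous_on UNIV g" by simp
  then have "g \<in> borel_measurable borel" by (rule borel_measurable_continuous_onI)
  then have g: "g \<in> borel_measurable (\<Pi>\<^sub>M i\<in>UNIV. borel)"
    by (subst measurable_cong_sets[OF sets_PiM_equal_borel refl])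
  have ext: "(\<lambda>x. \<lambda>i\<in>UNIV. if i \<in> I then x i else 0) \<in>
      measurable (\<Pi>\<^sub>M i\<in>I. (borel :: real measure)) (\<Pi>\<^sub>M i\<in>UNIV. borel)"
    by (rule measurable_restrict) (auto intro: measurable_component_singleton)
  show ?thesis
  proof (rule measurable_cong[THEN iffD1, OF _ measurable_compose[OF ext g]])
    fix x assume "x \<in> space (\<Pi>\<^sub>M i\<in>I. (borel :: real measure))"
    then have "restrict (\<lambda>i\<in>UNIV. if i \<in> I then x i else 0) I = x"
      by (auto simp: space_PiM PiE_def extensional_def)
    then show "g (\<lambda>i\<in>UNIV. if i \<in> I then x i else 0) = f x" by (simp add: g_def)
  qed
qed

lemma measurable_PiM_borel_coordinate:
  "(\<lambda>v. v t) \<in> borel_measurable (\<Pi>\<^sub>M i\<in>I. (borel :: real measure))"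
  using measurable_PiM_lborel_coordinate[of t I]
  by (subst measurable_cong_sets[OF sets_PiM_cong[OF refl, of _ _ "\<lambda>_. lborel"] refl]) auto

lemma measurable_path_sum_rescaled:
  "(\<lambda>w. path_sum (rescaled_coeffs \<gamma> n w) s i) \<in> borel_measurable (\<Pi>\<^sub>M i\<in>{..<k}. borel)"
  unfolding rescaled_coeffs_def[abs_def]
  by (intro measurable_path_sum_compose borel_measurable_add borel_measurable_times
      borel_measurable_const measurable_PiM_borel_coordinate)

lemma measurable_normalized_moments:
  assumes "\<And>j. j < k \<Longrightarrow> (\<lambda>x. g x (j + 1)) \<in> borel_measurable M"
  shows "(\<lambda>x. normalized_moments n k (g x)) \<in> measurable M (\<Pi>\<^sub>M i\<in>{..<k}. borel)"
proof -
  obtain B where B: "mat_inverse (D_mat k) = Some B" "B \<in> carrier_mat k k"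
    by (rule D_mat_inverse, rule that)
  show ?thesis
    unfolding normalized_moments_eq[OF B] using assms
    by (intro measurable_restrict borel_measurable_sum borel_measurable_times borel_measurable_diff
        borel_measurable_const) auto
qed

lemma normalized_moments_cong:
  assumes "\<And>j. j < k \<Longrightarrow> m (j + 1) = m' (j + 1)"
  shows "normalized_moments n k m = normalized_moments n k m'"
proof -
  obtain B where B: "mat_inverse (D_mat k) = Some B" "B \<in> carrier_mat k k"
    by (rule D_mat_inverse, rule that)
  show ?thesis
    unfolding normalized_moments_eq[OF B] using assms by (intro restrict_ext sum.cong) auto
qed

text \<open>All the randomness is moved to a density on a fixed space: by independence the first \<open>k\<close>
  coefficients have a product law, and standardizing each of them leaves an integral over \<open>\<real>\<^sup>k\<close>
  in which \<open>n\<close> occurs only in the densities and in the integrand.\<close>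

lemma integral_normalized_moments:
  fixes f :: "(nat \<Rightarrow> real) \<Rightarrow> real"
  assumes \<gamma>: "\<And>j. j \<ge> 1 \<Longrightarrow> \<gamma> j > -1"
    and r_pos: "\<And>j. j \<in> {1..2*n-1} \<Longrightarrow> r j > 0"
    and r_odd: "\<And>j. j \<in> {1..n} \<Longrightarrow> odd j \<Longrightarrow> r j = real n"
    and r_even: "\<And>j. j \<in> {1..n} \<Longrightarrow> even j \<Longrightarrow> r j = 2 * real n"
    and P: "prob_space M"
    and X: "distributed M (lebesgue_upto (2*n-1)) X (\<lambda>m. ennreal (moment_density n \<gamma> r m))"
    and kn: "k \<le> n" and n: "n \<ge> 1"
    and \<tau>: "\<And>s. s \<in> {1..k} \<Longrightarrow> even s \<Longrightarrow> gamma_shape_pred \<gamma> n (s div 2) > 0"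
    and f: "f \<in> borel_measurable (\<Pi>\<^sub>M i\<in>{..<k}. borel)"
  shows "(LINT x|distr M (\<Pi>\<^sub>M i\<in>{..<k}. borel) (\<lambda>\<omega>. normalized_moments n k (X \<omega>)). f x) =
     (LINT w|(\<Pi>\<^sub>M i\<in>{..<k}. lborel). (\<Prod>i<k. standardized_density \<gamma> n (i + 1) (w i)) *
        f (normalized_moments n k (\<lambda>s. path_sum (rescaled_coeffs \<gamma> n w) s 0)))"
proof -
  \<comment> \<open>This keeps the index sets in the form \<open>{1..N}\<close>.\<close>
  note One_nat_def[simp del]
  define N where "N = 2 * n - 1"
  define p where "p s x = coeff_density n \<gamma> r s x" for s x
  define q where "q i x = standardized_density \<gamma> n (i + 1) x" for i x
  have kN: "k \<le> N" using kn n by (simp add: N_def)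
  have pp: "prob_space (density lborel (\<lambda>x. ennreal (p s x)))" if "s \<in> {1..N}" for s
    unfolding p_def using \<gamma> r_pos that by (intro coeff_density_nonneg_prob(2)) (auto simp: N_def)
  have pn: "p s x \<ge> 0" if "s \<in> {1..N}" for s x
    unfolding p_def using \<gamma> r_pos that by (intro coeff_density_nonneg_prob(1)) (auto simp: N_def)
  have scale: "coeff_scale \<gamma> n (i + 1) > 0" if "i < k" for i
    using n \<tau>[of "i + 1"] that by (auto simp: coeff_scale_def)
  have rescale: "coeff_scale \<gamma> n (i + 1) * p (i + 1) (coeff_center \<gamma> n (i + 1) + coeff_scale \<gamma> n (i + 1) * x) = q i x"
    if "i < k" for i x
    unfolding p_def q_def using that kn
    by (intro coeff_density_rescaled n \<tau> r_odd r_even) auto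
  have affine: "density lborel (\<lambda>x. ennreal (p (i + 1) x)) =
      distr (density lborel (\<lambda>x. ennreal (q i x))) borel
        (\<lambda>x. coeff_center \<gamma> n (i + 1) + coeff_scale \<gamma> n (i + 1) * x)" if "i < k" for i
    unfolding rescale[OF that, symmetric] using scale[OF that]
    by (intro density_lborel_affine) (simp_all add: p_def[abs_def])
  have q_meas: "q i \<in> borel_measurable borel" for i by (simp add: q_def[abs_def])
  have qn: "q i x \<ge> 0" if "i < k" for i x
    unfolding rescale[OF that, symmetric] using scale[OF that] pn[of "i + 1"] that kN
    by (intro mult_nonneg_nonneg) auto
  have qp: "prob_space (density lborel (\<lambda>x. ennreal (q i x)))" if "i < k" for i
  proof (rule prob_spaceI)
    have "prob_space (distr (density lborel (\<lambda>x. ennreal (q i x))) borel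
        (\<lambda>x. coeff_center \<gamma> n (i + 1) + coeff_scale \<gamma> n (i + 1) * x))"
      using pp[of "i + 1"] that kN unfolding affine[OF that, symmetric] by simp
    from prob_space.emeasure_space_1[OF this]
    show "emeasure (density lborel (\<lambda>x. ennreal (q i x))) (space (density lborel (\<lambda>x. ennreal (q i x)))) = 1"
      by (simp add: emeasure_distr)
  qed
  define G where "G v = f (normalized_moments n k (\<lambda>s. path_sum (\<lambda>t. v (t - 1)) s 0))" for v :: "nat \<Rightarrow> real"
  have G: "G \<in> borel_measurable (\<Pi>\<^sub>M i\<in>{..<k}. borel)"
    unfolding G_def
    by (intro measurable_compose[OF measurable_normalized_moments f] measurable_path_sum_compose
        measurable_PiM_borel_coordinate)
  have sets1: "sets (\<Pi>\<^sub>M i\<in>{..<k}. density lborel (\<lambda>x. ennreal (g i x))) = sets (\<Pi>\<^sub>M i\<in>{..<k}. borel)"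
    for g :: "nat \<Rightarrow> real \<Rightarrow> real"
    by (intro sets_PiM_cong) auto
  have Xm: "X \<in> measurable M (lebesgue_upto N)"
    using distributed_measurable[OF X] by (simp add: N_def)
  have nmN: "(\<lambda>m. normalized_moments n k m) \<in> measurable (lebesgue_upto N) (\<Pi>\<^sub>M i\<in>{..<k}. borel)"
    by (rule measurable_normalized_moments) simp
  have "(LINT x|distr M (\<Pi>\<^sub>M i\<in>{..<k}. borel) (\<lambda>\<omega>. normalized_moments n k (X \<omega>)). f x) =
      (LINT m|distr M (lebesgue_upto N) X. f (normalized_moments n k m))"
    using integral_distr[OF measurable_compose[OF Xm nmN] f]
      integral_distr[OF Xm measurable_compose[OF nmN f]] by simp
  also have "distr M (lebesgue_upto N) X =
     distr (\<Pi>\<^sub>M s\<in>{1..N}. density lborel (\<lambda>x. ennreal (p s x))) (lebesgue_upto N) (moment_map N)"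
    unfolding N_def p_def using \<gamma> r_pos n P X by (intro distr_moments_eq)
  also have "(LINT m|\<dots>. f (normalized_moments n k m)) =
      (LINT u|(\<Pi>\<^sub>M s\<in>{1..N}. density lborel (\<lambda>x. ennreal (p s x))). f (normalized_moments n k (moment_map N u)))"
  proof (rule integral_distr)
    have "sets (\<Pi>\<^sub>M s\<in>{1..N}. density lborel (\<lambda>x. ennreal (p s x))) = sets (lebesgue_upto N)"
      by (intro sets_PiM_cong) auto
    then show "moment_map N \<in> measurable (\<Pi>\<^sub>M s\<in>{1..N}. density lborel (\<lambda>x. ennreal (p s x))) (lebesgue_upto N)"
      using measurable_moment_map by (subst measurable_cong_sets[OF _ refl])
    show "(\<lambda>m. f (normalized_moments n k m)) \<in> borel_measurable (lebesgue_upto N)"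
      by (rule measurable_compose[OF nmN f])
  qed
  also have "\<dots> = (LINT u|(\<Pi>\<^sub>M s\<in>{1..N}. density lborel (\<lambda>x. ennreal (p s x))). G (\<lambda>i\<in>{..<k}. u (Suc i)))"
  proof (rule Bochner_Integration.integral_cong[OF refl])
    fix u :: "nat \<Rightarrow> real"
    have "moment_map N u (j + 1) = path_sum (\<lambda>t. (\<lambda>i\<in>{..<k}. u (Suc i)) (t - 1)) (j + 1) 0" if "j < k" for j
    proof -
      have "moment_map N u (j + 1) = path_sum u (j + 1) 0"
        using that kN by (simp add: moment_map_def del: path_sum.simps)
      also have "\<dots> = path_sum (\<lambda>t. (\<lambda>i\<in>{..<k}. u (Suc i)) (t - 1)) (j + 1) 0"
        using that by (intro path_sum_cong) auto
      finally show ?thesis .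
    qed
    then show "f (normalized_moments n k (moment_map N u)) = G (\<lambda>i\<in>{..<k}. u (Suc i))"
      unfolding G_def by (intro arg_cong[where f = f] normalized_moments_cong)
  qed
  also have "\<dots> = (LINT v|(\<Pi>\<^sub>M i\<in>{..<k}. density lborel (\<lambda>x. ennreal (p (Suc i) x))). G v)"
  proof -
    have reindex: "distr (\<Pi>\<^sub>M s\<in>{1..N}. density lborel (\<lambda>x. ennreal (p s x)))
        (\<Pi>\<^sub>M i\<in>{..<k}. density lborel (\<lambda>x. ennreal (p (Suc i) x))) (\<lambda>u. \<lambda>i\<in>{..<k}. u (Suc i)) =
      (\<Pi>\<^sub>M i\<in>{..<k}. density lborel (\<lambda>x. ennreal (p (Suc i) x)))"
      using pp kN by (intro distr_PiM_reindex) auto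
    have meas: "(\<lambda>u. \<lambda>i\<in>{..<k}. u (Suc i)) \<in> measurable (\<Pi>\<^sub>M s\<in>{1..N}. density lborel (\<lambda>x. ennreal (p s x)))
        (\<Pi>\<^sub>M i\<in>{..<k}. density lborel (\<lambda>x. ennreal (p (Suc i) x)))"
      using kN by (intro measurable_restrict measurable_component_singleton) auto
    have "G \<in> borel_measurable (\<Pi>\<^sub>M i\<in>{..<k}. density lborel (\<lambda>x. ennreal (p (Suc i) x)))"
      using G by (subst measurable_cong_sets[OF sets1 refl])
    from integral_distr[OF meas this] show ?thesis unfolding reindex by simp
  qed
  also have "(\<Pi>\<^sub>M i\<in>{..<k}. density lborel (\<lambda>x. ennreal (p (Suc i) x))) =
      distr (\<Pi>\<^sub>M i\<in>{..<k}. density lborel (\<lambda>x. ennreal (q i x))) (\<Pi>\<^sub>M i\<in>{..<k}. borel)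
        (\<lambda>w. \<lambda>i\<in>{..<k}. coeff_center \<gamma> n (i + 1) + coeff_scale \<gamma> n (i + 1) * w i)"
  proof -
    have "(\<Pi>\<^sub>M i\<in>{..<k}. density lborel (\<lambda>x. ennreal (p (Suc i) x))) =
      (\<Pi>\<^sub>M i\<in>{..<k}. distr (density lborel (\<lambda>x. ennreal (q i x))) borel
        (\<lambda>x. coeff_center \<gamma> n (i + 1) + coeff_scale \<gamma> n (i + 1) * x))"
      using affine by (intro PiM_cong) (simp_all only: Suc_eq_plus1 lessThan_iff)
    also have "\<dots> = distr (\<Pi>\<^sub>M i\<in>{..<k}. density lborel (\<lambda>x. ennreal (q i x))) (\<Pi>\<^sub>M i\<in>{..<k}. borel)
        (\<lambda>w. \<lambda>i\<in>{..<k}. coeff_center \<gamma> n (i + 1) + coeff_scale \<gamma> n (i + 1) * w i)"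
      using qp by (intro PiM_distr_componentwise) auto
    finally show ?thesis .
  qed
  also have "(LINT v|\<dots>. G v) = (LINT w|(\<Pi>\<^sub>M i\<in>{..<k}. density lborel (\<lambda>x. ennreal (q i x))).
      G (\<lambda>i\<in>{..<k}. coeff_center \<gamma> n (i + 1) + coeff_scale \<gamma> n (i + 1) * w i))"
  proof (rule integral_distr[OF _ G])
    have "(\<lambda>w. w i) \<in> borel_measurable (\<Pi>\<^sub>M i\<in>{..<k}. density lborel (\<lambda>x. ennreal (q i x)))" if "i < k" for i
      using measurable_component_singleton[of i "{..<k}" "\<lambda>i. density lborel (\<lambda>x. ennreal (q i x))"] that by simp
    then show "(\<lambda>w. \<lambda>i\<in>{..<k}. coeff_center \<gamma> n (i + 1) + coeff_scale \<gamma> n (i + 1) * w i)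
        \<in> measurable (\<Pi>\<^sub>M i\<in>{..<k}. density lborel (\<lambda>x. ennreal (q i x))) (\<Pi>\<^sub>M i\<in>{..<k}. borel)"
      by (intro measurable_restrict borel_measurable_add borel_measurable_times borel_measurable_const) auto
  qed
  also have "\<dots> = (LINT w|(\<Pi>\<^sub>M i\<in>{..<k}. density lborel (\<lambda>x. ennreal (q i x))).
      f (normalized_moments n k (\<lambda>s. path_sum (rescaled_coeffs \<gamma> n w) s 0)))"
  proof (rule Bochner_Integration.integral_cong[OF refl])
    fix w :: "nat \<Rightarrow> real"
    show "G (\<lambda>i\<in>{..<k}. coeff_center \<gamma> n (i + 1) + coeff_scale \<gamma> n (i + 1) * w i) =
        f (normalized_moments n k (\<lambda>s. path_sum (rescaled_coeffs \<gamma> n w) s 0))"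
      unfolding G_def
      by (intro arg_cong[where f = f] normalized_moments_cong path_sum_cong) (auto simp: rescaled_coeffs_def)
  qed
  also have "\<dots> = (LINT w|(\<Pi>\<^sub>M i\<in>{..<k}. lborel). (\<Prod>i<k. q i (w i)) *
        f (normalized_moments n k (\<lambda>s. path_sum (rescaled_coeffs \<gamma> n w) s 0)))"
  proof (rule integral_PiM_density)
    show "(\<lambda>w. f (normalized_moments n k (\<lambda>s. path_sum (rescaled_coeffs \<gamma> n w) s 0)))
        \<in> borel_measurable (\<Pi>\<^sub>M i\<in>{..<k}. borel)"
      by (intro measurable_compose[OF measurable_normalized_moments f] measurable_path_sum_rescaled)
  qed (use q_meas qn qp in auto)
  finally show ?thesis by (simp only: q_def)
qed

text \<open>In the integral over \<open>\<real>\<^sup>k\<close> given by \<open>integral_normalized_moments\<close>, the densities and the integrand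
  converge pointwise, and \<open>integrable_prod_dominating_density\<close> provides the dominating function.\<close>

theorem theorem3p6:
  fixes M :: "nat \<Rightarrow> 'a measure"
    and X :: "nat \<Rightarrow> 'a \<Rightarrow> nat \<Rightarrow> real"
    and \<gamma> :: "nat \<Rightarrow> real"
    and \<delta> :: "nat \<Rightarrow> nat \<Rightarrow> real"
    and k :: nat
  assumes "\<And>j. j \<ge> 1 \<Longrightarrow> \<gamma> j > -1"
    and "\<And>n j. n \<ge> 1 \<Longrightarrow> j \<in> {1..2*n-1} \<Longrightarrow> \<delta> n j > 0"
    and "\<And>n j. n \<ge> 1 \<Longrightarrow> j \<in> {1..n} \<Longrightarrow> odd j \<Longrightarrow> \<delta> n j = real n"
    and "\<And>n j. n \<ge> 1 \<Longrightarrow> j \<in> {1..n} \<Longrightarrow> even j \<Longrightarrow> \<delta> n j = 2 * real n"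
    and "\<And>n. n \<ge> 1 \<Longrightarrow> prob_space (M n)"
    and "\<And>n. n \<ge> 1 \<Longrightarrow>
           distributed (M n) (\<Pi>\<^sub>M i\<in>{1..2*n-1}. lborel) (X n)
             (\<lambda>m. ennreal (moment_density n \<gamma> (\<delta> n) m))"
    and "k \<ge> 1"
  shows "weak_conv_on (product_topology (\<lambda>_. euclideanreal) {..<k})
           (\<lambda>n. distr (M n) (\<Pi>\<^sub>M i\<in>{..<k}. borel) (\<lambda>\<omega>. normalized_moments n k (X n \<omega>)))
           (std_normal_vector k)"
  unfolding weak_conv_on_def
proof (intro allI impI, elim conjE)
  let ?T = "product_topology (\<lambda>_::nat. euclideanreal) {..<k}"
  fix f :: "(nat \<Rightarrow> real) \<Rightarrow> real"
  assume cont: "continuous_map ?T euclideanreal f" and "bounded (f ` topspace ?T)"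
  then obtain C where C: "\<And>x. x \<in> topspace ?T \<Longrightarrow> \<bar>f x\<bar> \<le> C"
    by (auto simp: bounded_iff)
  have f: "f \<in> borel_measurable (\<Pi>\<^sub>M i\<in>{..<k}. borel)"
    using cont by (rule continuous_map_product_borel_measurable)
  have sets: "sets (\<Pi>\<^sub>M i\<in>{..<k}. (lborel :: real measure)) = sets (\<Pi>\<^sub>M i\<in>{..<k}. borel)"
    by (intro sets_PiM_cong) auto
  define Z where "Z n w = normalized_moments n k (\<lambda>s. path_sum (rescaled_coeffs \<gamma> n w) s 0)" for n w
  have Z_top: "Z n w \<in> topspace ?T" for n w
    by (simp add: Z_def normalized_moments_def)
  have ev_shape: "eventually (\<lambda>n. \<forall>s\<in>{1..k}. even s \<longrightarrow> gamma_shape_pred \<gamma> n (s div 2) > 0) sequentially"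
    using gamma_shape_pred_at_top[unfolded filterlim_at_top_dense] by (intro eventually_ball_finite) (auto elim: eventually_mono)
  have ev: "eventually (\<lambda>n. (LINT x|distr (M n) (\<Pi>\<^sub>M i\<in>{..<k}. borel) (\<lambda>\<omega>. normalized_moments n k (X n \<omega>)). f x) =
      (LINT w|(\<Pi>\<^sub>M i\<in>{..<k}. lborel). (\<Prod>i<k. standardized_density \<gamma> n (i + 1) (w i)) * f (Z n w))) sequentially"
    using eventually_ge_at_top[of k] ev_shape
  proof eventually_elim
    case (elim n)
    then have n: "n \<ge> 1" using \<open>k \<ge> 1\<close> by linarith
    show ?case
      unfolding Z_def
      by (rule integral_normalized_moments[OF assms(1) assms(2)[OF n] assms(3)[OF n] assms(4)[OF n]
            assms(5)[OF n] assms(6)[OF n] elim(1) n _ f])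
         (use elim(2) in auto)
  qed
  have "(\<lambda>n. LINT w|(\<Pi>\<^sub>M i\<in>{..<k}. lborel). (\<Prod>i<k. standardized_density \<gamma> n (i + 1) (w i)) * f (Z n w))
      \<longlonglongrightarrow> (LINT w|(\<Pi>\<^sub>M i\<in>{..<k}. lborel). (\<Prod>i<k. std_normal_density (w i)) * f w)"
  proof -
    have "eventually (\<lambda>n. (\<forall>s\<in>{1..k}. even s \<longrightarrow> gamma_shape_pred \<gamma> n (s div 2) > 0) \<and>
        (\<forall>i\<in>{..<k}. \<forall>w. standardized_density \<gamma> n (i + 1) w \<le> dominating_density w)) sequentially"
      by (intro eventually_conj ev_shape eventually_ball_finite ballI standardized_density_le) auto
    then obtain n0 where n0': "\<forall>n\<ge>n0. (\<forall>s\<in>{1..k}. even s \<longrightarrow> gamma_shape_pred \<gamma> n (s div 2) > 0) \<and>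
        (\<forall>i\<in>{..<k}. \<forall>w. standardized_density \<gamma> n (i + 1) w \<le> dominating_density w)"
      unfolding eventually_sequentially by (rule exE)
    have n0: "\<And>n s. n \<ge> n0 \<Longrightarrow> s \<in> {1..k} \<Longrightarrow> even s \<Longrightarrow> gamma_shape_pred \<gamma> n (s div 2) > 0"
      "\<And>n i w. n \<ge> n0 \<Longrightarrow> i < k \<Longrightarrow> standardized_density \<gamma> n (i + 1) w \<le> dominating_density w"
      using n0' by (metis, metis lessThan_iff)
    define F where "F n w = (\<Prod>i<k. standardized_density \<gamma> n (i + 1) (w i)) * f (Z n w)" for n w
    have coord: "(\<lambda>w. g (w i)) \<in> borel_measurable (\<Pi>\<^sub>M i\<in>{..<k}. lborel)"
      if "g \<in> borel_measurable borel" for g :: "real \<Rightarrow> real" and i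
      by (rule measurable_compose[OF measurable_PiM_lborel_coordinate that])
    have Z_meas: "(\<lambda>w. f (Z n w)) \<in> borel_measurable (\<Pi>\<^sub>M i\<in>{..<k}. lborel)" for n
      unfolding Z_def measurable_cong_sets[OF sets refl]
      by (intro measurable_compose[OF measurable_normalized_moments f] measurable_path_sum_rescaled)
    have f': "f \<in> borel_measurable (\<Pi>\<^sub>M i\<in>{..<k}. lborel)"
      using f unfolding measurable_cong_sets[OF sets refl] .
    \<comment> \<open>The bounds hold from \<open>n0\<close> on, hence the shift of the sequence.\<close>
    have "(\<lambda>n. LINT w|(\<Pi>\<^sub>M i\<in>{..<k}. lborel). F (n + n0) w)
      \<longlonglongrightarrow> (LINT w|(\<Pi>\<^sub>M i\<in>{..<k}. lborel). (\<Prod>i<k. std_normal_density (w i)) * f w)"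
    proof (rule integral_dominated_convergence)
      show "(\<lambda>w. (\<Prod>i<k. std_normal_density (w i)) * f w) \<in> borel_measurable (\<Pi>\<^sub>M i\<in>{..<k}. lborel)"
        by (intro borel_measurable_times borel_measurable_prod coord f') simp
      show "F (n + n0) \<in> borel_measurable (\<Pi>\<^sub>M i\<in>{..<k}. lborel)" for n
        unfolding F_def[abs_def]
        by (intro borel_measurable_times borel_measurable_prod coord Z_meas measurable_standardized_density)
      show "integrable (\<Pi>\<^sub>M i\<in>{..<k}. lborel) (\<lambda>w. (\<Prod>i<k. dominating_density (w i)) * C)"
        by (intro integrable_mult_left integrable_prod_dominating_density)
      show "AE w in (\<Pi>\<^sub>M i\<in>{..<k}. lborel). (\<lambda>n. F (n + n0) w) \<longlonglongrightarrow> (\<Prod>i<k. std_normal_density (w i)) * f w"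
      proof (rule AE_I2)
        fix w :: "nat \<Rightarrow> real" assume "w \<in> space (\<Pi>\<^sub>M i\<in>{..<k}. lborel)"
        then have w: "w \<in> {..<k} \<rightarrow>\<^sub>E UNIV" by (simp add: space_PiM)
        have "limitin euclideanreal (f \<circ> (\<lambda>n. Z n w)) (f w) sequentially"
          unfolding Z_def by (rule continuous_map_limit[OF cont normalized_moments_tendsto[OF w]])
        then have "(\<lambda>n. f (Z n w)) \<longlonglongrightarrow> f w" by (simp add: comp_def)
        then have "(\<lambda>n. F n w) \<longlonglongrightarrow> (\<Prod>i<k. std_normal_density (w i)) * f w"
          unfolding F_def by (intro tendsto_mult tendsto_prod standardized_density_tendsto)
        then show "(\<lambda>n. F (n + n0) w) \<longlonglongrightarrow> (\<Prod>i<k. std_normal_density (w i)) * f w"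
          by (rule LIMSEQ_ignore_initial_segment)
      qed
      show "AE w in (\<Pi>\<^sub>M i\<in>{..<k}. lborel). norm (F (n + n0) w) \<le> (\<Prod>i<k. dominating_density (w i)) * C" for n
      proof (rule AE_I2)
        fix w :: "nat \<Rightarrow> real"
        have nonneg: "standardized_density \<gamma> (n + n0) (i + 1) x \<ge> 0" if "i < k" for i x
          using n0(1)[of "n + n0" "i + 1"] that by (intro standardized_density_nonneg) auto
        have "norm (F (n + n0) w) = (\<Prod>i<k. standardized_density \<gamma> (n + n0) (i + 1) (w i)) * \<bar>f (Z (n + n0) w)\<bar>"
          using nonneg by (simp add: F_def abs_mult abs_prod)
        also have "\<dots> \<le> (\<Prod>i<k. dominating_density (w i)) * C"
          using nonneg n0(2) C[OF Z_top]
          by (intro mult_mono prod_mono prod_nonneg conjI ballI dominating_density_nonneg) auto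
        finally show "norm (F (n + n0) w) \<le> (\<Prod>i<k. dominating_density (w i)) * C" .
      qed
    qed
    then show ?thesis unfolding F_def by (rule LIMSEQ_offset)
  qed
  also have "(LINT w|(\<Pi>\<^sub>M i\<in>{..<k}. lborel). (\<Prod>i<k. std_normal_density (w i)) * f w) =
      (LINT x|std_normal_vector k. f x)"
    unfolding std_normal_vector_def
    by (rule integral_PiM_density[symmetric]) (auto intro: f prob_space_normal_density)
  finally show "(\<lambda>n. LINT x|distr (M n) (\<Pi>\<^sub>M i\<in>{..<k}. borel) (\<lambda>\<omega>. normalized_moments n k (X n \<omega>)). f x)
      \<longlonglongrightarrow> (LINT x|std_normal_vector k. f x)"
    by (rule Lim_transform_eventually) (use ev in \<open>auto elim: eventually_mono\<close>)
qed

end
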